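(* Let $\mathcal T$ be a finite rooted tree with root $o$, and let $\Omega$ be a real valued function on the vertices of $\mathcal T$ with $\Omega(o)=1$ and $\Omega(y)<\Omega(x)$ whenever $y<x$. For vertices $x,y$ set $k_{xy}=\Omega(x\wedge y)$. Let $K$ denote the kernel function for $DA_n$. Then: (1) The function $k_{xy}$ is the reproducing kernel for a reproducing kernel Hilbert space $H=H(\mathcal T,\Omega)$ of functions on $\mathcal T$. (2) The space $H$ has the complete Pick property. (3) For some $n$ there is a map $\Phi_\Omega:\mathcal T\to\mathbb{B}^n$ with $\Phi_\Omega(o)=0$ and, for all $x,y\in\mathcal T$, $k_{xy}=K_{\Phi_\Omega(x)\Phi_\Omega(y)}=\Omega(x\wedge y)$. Thus $H(\mathcal T,\Omega)=DA_n(\Phi_\Omega(\mathcal T))$.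
   Context: A rooted tree is a connected loopless (acyclic) graph with a distinguished root vertex $o$; we identify $\mathcal T$ with its vertex set. $[x,y]$ is the non-overlapping path joining $x$ and $y$; $w<x$ means $w\in[o,x)$; $x\wedge y$ is the maximal element of $[o,x]\cap[o,y]$. A finite dimensional reproducing kernel Hilbert space (RKHS) $H$ is a complex inner product space with a distinguished basis $\{k_x\}_{x\in X}$ (reproducing kernels), whose elements are regarded as functions on $X$ via $h(x)=\langle h,k_x\rangle$, and $k_{xy}=\langle k_x,k_y\rangle$. For $Y\subset X$ let $H_Y$ be the RKHS spanned by $\{k_y\}_{y\in Y}$. A multiplier of $H$ is an operator $h\mapsto mh$ of multiplication by a function $m$ on $X$, with operator norm. $H$ has the complete Pick property if for every $Y\subset X$ every (matrix-valued, of any size) multiplier of $H_Y$ of norm one extends to a (matrix-valued) multiplier of $H$ of norm one. $\mathbb{B}^n$ is the open unit ball of $\mathbb{C}^n$; $DA_n$ is the Hilbert space of holomorphic functions on $\mathbb{B}^n$ with reproducing kernels $K_z(w)=(1-\langle w,z\rangle)^{-1}$, and $K_{zw}=\langle K_z,K_w\rangle=K_z(w)$. For finite $Y\subset\mathbb{B}^n$, $DA_n(Y)$ is the RKHS spanned by $\{K_y\}_{y\in Y}$. In (3), points of $\mathcal T$ are identified with their images. *)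

theory Defs
  imports
    "HOL-Library.Function_Algebras"
    "Jordan_Normal_Form.Matrix"
    "Graph_Theory.Graph_Theory"
begin

section \<open>Rooted trees\<close>

text \<open>
  Undirected graphs are the symmetric loop-free digraphs of the locale \<open>pair_graph\<close>, which also
  requires finiteness. The library's \<open>tree\<close> forbids directed cycles, and in a symmetric digraph
  every edge gives one (\<open>x, y, x\<close>), so acyclicity is stated for undirected cycles here.
\<close>

definition finite_rooted_tree :: "'v pair_pre_digraph \<Rightarrow> 'v \<Rightarrow> bool" where
  "finite_rooted_tree T r \<longleftrightarrow>
     pair_graph T \<and> Digraph_Component.connected (with_proj T) \<and>
     \<not> (\<exists>p. vpath p (with_proj T) \<and> 3 \<le> length p \<and> (last p, hd p) \<in> parcs T) \<and>
     r \<in> pverts T"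

definition segment :: "'v pair_pre_digraph \<Rightarrow> 'v \<Rightarrow> 'v \<Rightarrow> 'v set" where
  "segment T x y = set (THE p. vpath p (with_proj T) \<and> hd p = x \<and> last p = y)"

definition tree_less :: "'v pair_pre_digraph \<Rightarrow> 'v \<Rightarrow> 'v \<Rightarrow> 'v \<Rightarrow> bool" where
  "tree_less T r w x \<longleftrightarrow> w \<in> segment T r x - {x}"

definition tree_meet :: "'v pair_pre_digraph \<Rightarrow> 'v \<Rightarrow> 'v \<Rightarrow> 'v \<Rightarrow> 'v" where
  "tree_meet T r x y =
     (THE z. z \<in> segment T r x \<inter> segment T r y \<and>
             \<not> (\<exists>w \<in> segment T r x \<inter> segment T r y. tree_less T r z w))"

definition tree_kernel :: "'v pair_pre_digraph \<Rightarrow> 'v \<Rightarrow> ('v \<Rightarrow> real) \<Rightarrow> 'v \<Rightarrow> 'v \<Rightarrow> complex" where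
  "tree_kernel T r \<Omega> x y = complex_of_real (\<Omega> (tree_meet T r x y))"


section \<open>Reproducing kernel Hilbert spaces\<close>

interpretation cfun: vector_space "\<lambda>(c::complex) (f::'x \<Rightarrow> complex) x. c * f x"
  by unfold_locales (auto simp: fun_eq_iff algebra_simps)

text \<open>
  A space of complex functions on a set of points. Functions on \<open>pts H\<close> are represented by functions
  on the whole type that vanish off \<open>pts H\<close>. The values of \<open>ip H\<close> off \<open>funs H\<close>, and of \<open>ker H\<close>
  off \<open>pts H\<close>, are irrelevant. The vector \<open>ker H x\<close> is the kernel function \<open>k\<^sub>x\<close>.
\<close>

record 'x function_space =
  pts :: "'x set"
  funs :: "('x \<Rightarrow> complex) set"
  ip :: "('x \<Rightarrow> complex) \<Rightarrow> ('x \<Rightarrow> complex) \<Rightarrow> complex"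
  ker :: "'x \<Rightarrow> 'x \<Rightarrow> complex"

definition inner_product_space :: "'x function_space \<Rightarrow> bool" where
  "inner_product_space H \<longleftrightarrow>
     cfun.subspace (funs H) \<and>
     (\<forall>f \<in> funs H. \<forall>x. x \<notin> pts H \<longrightarrow> f x = 0) \<and>
     (\<forall>f \<in> funs H. \<forall>g \<in> funs H. \<forall>h \<in> funs H. ip H (f + g) h = ip H f h + ip H g h) \<and>
     (\<forall>c. \<forall>f \<in> funs H. \<forall>g \<in> funs H. ip H (\<lambda>x. c * f x) g = c * ip H f g) \<and>
     (\<forall>f \<in> funs H. \<forall>g \<in> funs H. ip H g f = cnj (ip H f g)) \<and>
     (\<forall>f \<in> funs H. 0 \<le> Re (ip H f f)) \<and>
     (\<forall>f \<in> funs H. ip H f f = 0 \<longrightarrow> f = 0)"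

definition rkhs :: "'x function_space \<Rightarrow> bool" where
  "rkhs H \<longleftrightarrow> inner_product_space H \<and>
     (\<forall>x \<in> pts H. ker H x \<in> funs H) \<and>
     (\<forall>x \<in> pts H. \<forall>f \<in> funs H. f x = ip H f (ker H x))"

text \<open>The family \<open>(k\<^sub>x)\<^sub>x\<close> is a basis.\<close>

definition finite_rkhs :: "'x function_space \<Rightarrow> bool" where
  "finite_rkhs H \<longleftrightarrow> rkhs H \<and> finite (pts H) \<and>
     inj_on (ker H) (pts H) \<and> cfun.independent (ker H ` pts H) \<and>
     funs H = cfun.span (ker H ` pts H)"

definition has_kernel :: "'x function_space \<Rightarrow> ('x \<Rightarrow> 'x \<Rightarrow> complex) \<Rightarrow> bool" where
  "has_kernel H k \<longleftrightarrow> (\<forall>x \<in> pts H. \<forall>y \<in> pts H. ip H (ker H x) (ker H y) = k x y)"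

definition restrict0 :: "'x set \<Rightarrow> ('x \<Rightarrow> complex) \<Rightarrow> 'x \<Rightarrow> complex" where
  "restrict0 Y f = (\<lambda>x. if x \<in> Y then f x else 0)"

text \<open>
  The space \<open>H\<^sub>Y\<close> spanned by the \<open>k\<^sub>y\<close>, \<open>y \<in> Y\<close>, with the inner product of \<open>H\<close>. Its elements are
  regarded as functions on \<open>Y\<close> through \<open>y \<mapsto> \<langle>h, k\<^sub>y\<rangle> = h y\<close>. Restriction to \<open>Y\<close> is injective on the
  span, since an element of the span vanishing on \<open>Y\<close> is orthogonal to the span.
\<close>

definition rkhs_sub :: "'x function_space \<Rightarrow> 'x set \<Rightarrow> 'x function_space" where
  "rkhs_sub H Y =
     (let S = cfun.span (ker H ` Y); lift = the_inv_into S (restrict0 Y)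
      in \<lparr> pts = Y,
           funs = restrict0 Y ` S,
           ip = (\<lambda>f g. ip H (lift f) (lift g)),
           ker = (\<lambda>y. restrict0 Y (ker H y)) \<rparr>)"

definition pullback :: "('x \<Rightarrow> 'y) \<Rightarrow> 'x set \<Rightarrow> ('y \<Rightarrow> complex) \<Rightarrow> 'x \<Rightarrow> complex" where
  "pullback \<Phi> X f = (\<lambda>x. if x \<in> X then f (\<Phi> x) else 0)"

text \<open>Equality of \<open>H\<close> and \<open>G\<close> once each point \<open>x\<close> of \<open>H\<close> is identified with \<open>\<Phi> x\<close>.\<close>

definition same_rkhs_via :: "('x \<Rightarrow> 'y) \<Rightarrow> 'x function_space \<Rightarrow> 'y function_space \<Rightarrow> bool" where
  "same_rkhs_via \<Phi> H G \<longleftrightarrow>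
     bij_betw \<Phi> (pts H) (pts G) \<and>
     funs H = pullback \<Phi> (pts H) ` funs G \<and>
     (\<forall>f \<in> funs G. \<forall>g \<in> funs G.
        ip H (pullback \<Phi> (pts H) f) (pullback \<Phi> (pts H) g) = ip G f g) \<and>
     (\<forall>x \<in> pts H. ker H x = pullback \<Phi> (pts H) (ker G (\<Phi> x)))"


section \<open>Multipliers and the complete Pick property\<close>

text \<open>
  A \<open>p \<times> q\<close> matrix-valued function \<open>M\<close> acts on \<open>q\<close>-tuples of elements of \<open>H\<close>, i.e. on the Hilbert
  space \<open>H \<otimes> \<complex>\<^sup>q\<close>; only the entries \<open>h j\<close> with \<open>j < q\<close> matter. Scalar multipliers are the case
  \<open>p = q = 1\<close>.
\<close>

definition tuples :: "'x function_space \<Rightarrow> nat \<Rightarrow> (nat \<Rightarrow> 'x \<Rightarrow> complex) set" where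
  "tuples H q = {h. \<forall>j<q. h j \<in> funs H}"

definition tuple_norm :: "'x function_space \<Rightarrow> nat \<Rightarrow> (nat \<Rightarrow> 'x \<Rightarrow> complex) \<Rightarrow> real" where
  "tuple_norm H q h = sqrt (\<Sum>j<q. Re (ip H (h j) (h j)))"

definition mult_op ::
    "'x function_space \<Rightarrow> nat \<Rightarrow> ('x \<Rightarrow> complex mat) \<Rightarrow> (nat \<Rightarrow> 'x \<Rightarrow> complex) \<Rightarrow> nat \<Rightarrow> 'x \<Rightarrow> complex" where
  "mult_op H q M h i = restrict0 (pts H) (\<lambda>x. \<Sum>j<q. M x $$ (i, j) * h j x)"

definition mult_unit_values ::
    "'x function_space \<Rightarrow> nat \<Rightarrow> nat \<Rightarrow> ('x \<Rightarrow> complex mat) \<Rightarrow> real set" where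
  "mult_unit_values H p q M =
     {tuple_norm H p (mult_op H q M h) | h. h \<in> tuples H q \<and> tuple_norm H q h \<le> 1}"

definition is_multiplier ::
    "'x function_space \<Rightarrow> nat \<Rightarrow> nat \<Rightarrow> ('x \<Rightarrow> complex mat) \<Rightarrow> bool" where
  "is_multiplier H p q M \<longleftrightarrow>
     (\<forall>x \<in> pts H. M x \<in> carrier_mat p q) \<and>
     (\<forall>h \<in> tuples H q. mult_op H q M h \<in> tuples H p) \<and>
     bdd_above (mult_unit_values H p q M)"

definition multiplier_norm ::
    "'x function_space \<Rightarrow> nat \<Rightarrow> nat \<Rightarrow> ('x \<Rightarrow> complex mat) \<Rightarrow> real" where
  "multiplier_norm H p q M = Sup (mult_unit_values H p q M)"

definition complete_pick :: "'x function_space \<Rightarrow> bool" where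
  "complete_pick H \<longleftrightarrow>
     (\<forall>Y \<subseteq> pts H. \<forall>p q M.
        is_multiplier (rkhs_sub H Y) p q M \<and> multiplier_norm (rkhs_sub H Y) p q M = 1 \<longrightarrow>
        (\<exists>N. is_multiplier H p q N \<and> multiplier_norm H p q N = 1 \<and> (\<forall>y \<in> Y. N y = M y)))"


section \<open>The space \<open>DA\<^sub>n\<close>\<close>

definition cvec_norm :: "complex vec \<Rightarrow> real" where
  "cvec_norm z = sqrt (Re (z \<bullet>c z))"

definition unit_cball :: "nat \<Rightarrow> complex vec set" where
  "unit_cball n = {z \<in> carrier_vec n. cvec_norm z < 1}"

text \<open>The value \<open>K\<^sub>z(w) = (1 - \<langle>w, z\<rangle>)\<^sup>-\<^sup>1\<close>, the inner product being linear in the first argument.\<close>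

definition DA_kernel :: "complex vec \<Rightarrow> complex vec \<Rightarrow> complex" where
  "DA_kernel z w = inverse (1 - w \<bullet>c z)"

text \<open>Complex Frechet differentiability at every point of the ball, with gradient \<open>a\<close>.\<close>

definition holomorphic_on_ball :: "nat \<Rightarrow> (complex vec \<Rightarrow> complex) \<Rightarrow> bool" where
  "holomorphic_on_ball n f \<longleftrightarrow>
     (\<forall>z \<in> unit_cball n. \<exists>a \<in> carrier_vec n. \<forall>\<epsilon>>0. \<exists>\<delta>>0. \<forall>w \<in> unit_cball n.
        cvec_norm (w - z) < \<delta> \<longrightarrow> cmod (f w - f z - a \<bullet> (w - z)) \<le> \<epsilon> * cvec_norm (w - z))"

definition hilbert_complete :: "'x function_space \<Rightarrow> bool" where
  "hilbert_complete H \<longleftrightarrow>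
     (\<forall>f. (\<forall>i::nat. f i \<in> funs H) \<and>
          (\<forall>\<epsilon>>0. \<exists>N. \<forall>i\<ge>N. \<forall>j\<ge>N. sqrt (Re (ip H (f i - f j) (f i - f j))) < \<epsilon>) \<longrightarrow>
          (\<exists>g \<in> funs H. (\<lambda>i. sqrt (Re (ip H (f i - g) (f i - g)))) \<longlonglongrightarrow> 0))"

definition drury_arveson :: "nat \<Rightarrow> complex vec function_space \<Rightarrow> bool" where
  "drury_arveson n D \<longleftrightarrow>
     rkhs D \<and> hilbert_complete D \<and> pts D = unit_cball n \<and>
     (\<forall>f \<in> funs D. holomorphic_on_ball n f) \<and>
     (\<forall>z \<in> unit_cball n. \<forall>w \<in> unit_cball n. ker D z w = DA_kernel z w)"

text \<open>
  \<open>G\<close> is \<open>DA\<^sub>n(Y)\<close>. Since the Hilbert space \<open>DA\<^sub>n\<close> is given by its defining property and not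
  constructed, the first three conjuncts describe \<open>DA\<^sub>n(Y)\<close> without reference to it: \<open>G\<close> is the
  space of functions on \<open>Y\<close> with basis \<open>(K\<^sub>y)\<close> and Gram matrix \<open>(K\<^sub>z\<^sub>w)\<close>. The last one
  says that it is the subspace of \<open>DA\<^sub>n\<close> spanned by the \<open>K\<^sub>y\<close>.
\<close>

definition is_DA_span :: "nat \<Rightarrow> complex vec set \<Rightarrow> complex vec function_space \<Rightarrow> bool" where
  "is_DA_span n Y G \<longleftrightarrow>
     finite_rkhs G \<and> pts G = Y \<and> has_kernel G DA_kernel \<and>
     (\<forall>D. drury_arveson n D \<longrightarrow> same_rkhs_via (\<lambda>y. y) G (rkhs_sub D Y))"

end

theory Submission
  imports Defs "HOL-Library.Sublist" "Jordan_Normal_Form.Determinant"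
begin

text \<open>
  Telescoping along the paths from the root writes \<open>f(x \<and> y)\<close>, for \<open>f\<close> increasing on the tree, as
  the inner product of the vectors with entries the square roots of the increments of \<open>f\<close> on
  \<open>[o, x]\<close> and \<open>[o, y]\<close>. With \<open>f = \<Omega>\<close> this shows that \<open>k\<close> is positive definite; with
  \<open>f = 1 - 1/\<Omega>\<close>, which vanishes at the root and is less than 1, it gives the map \<open>\<Phi>\<close> into the ball.
  Since \<open>1 - 1/k\<close> is a Gram kernel, a contractive multiplier on a subset extends to all vertices as a
  transfer function (lurking isometry), which is the complete Pick property.
\<close>

section \<open>Positive semidefinite kernels on finite sets\<close>

text \<open>The function 1 - 1/\<Omega> is forced: the Drury-Arveson kernel is 1/(1 - <w, z>), so
  the inner product of the images of x and y must be 1 - 1/k(x, y), and an entrywise function of a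
  kernel that depends only on the meet again depends only on the meet. Multipliers are defined
  through operator norms, whereas extension works with positive matrices. The bridge is the adjoint,
  which sends k_x tensored with a vector v to k_x tensored with M(x)^* v; a norm bound thus becomes
  positivity of a kernel on pairs of points and row indices, in which the entries of M appear
  conjugated. Since all sets are finite, the isometry matching the two families extends by zero to a
  contraction, and the transfer function at a new point only requires solving a linear system, which
  is possible because the images lie in the open ball. Extension alone yields norm at most one; that
  the norm is exactly one comes from running the norm criterion with an arbitrary bound and
  restricting the kernel back to Y.\<close>

definition sesq :: "'i set \<Rightarrow> ('i \<Rightarrow> 'i \<Rightarrow> complex) \<Rightarrow> ('i \<Rightarrow> complex) \<Rightarrow> ('i \<Rightarrow> complex) \<Rightarrow> complex" where
  "sesq S G c d = (\<Sum>i\<in>S. \<Sum>j\<in>S. c i * cnj (d j) * G i j)"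

text \<open>Hermitian symmetry is stated separately because the real part of the quadratic form sees
  only the Hermitian part of G.\<close>

definition psd_on :: "'i set \<Rightarrow> ('i \<Rightarrow> 'i \<Rightarrow> complex) \<Rightarrow> bool" where
  "psd_on S G \<longleftrightarrow> (\<forall>i\<in>S. \<forall>j\<in>S. G j i = cnj (G i j)) \<and> (\<forall>c. 0 \<le> Re (sesq S G c c))"

lemma sesq_diff_left: "sesq S G (\<lambda>j. f j - g j) d = sesq S G f d - sesq S G g d"
  by (simp add: sesq_def algebra_simps sum_subtractf)

lemma sesq_scale_left: "sesq S G (\<lambda>j. a * f j) d = a * sesq S G f d"
  by (simp add: sesq_def algebra_simps sum_distrib_left)

lemma sesq_sum_left:
  "sesq S G (\<lambda>j. \<Sum>k\<in>K. a k * f k j) d = (\<Sum>k\<in>K. a k * sesq S G (f k) d)"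
proof (induction K rule: infinite_finite_induct)
  case (insert x F)
  have "sesq S G (\<lambda>j. u j + v j) d = sesq S G u d + sesq S G v d" for u v
    by (simp add: sesq_def algebra_simps sum.distrib)
  with insert show ?case by (simp add: sesq_scale_left)
qed (simp_all add: sesq_def)

lemma sesq_cong:
  assumes "\<And>i j. i \<in> S \<Longrightarrow> j \<in> S \<Longrightarrow> G i j = G' i j"
    and "\<And>i. i \<in> S \<Longrightarrow> c i = c' i" and "\<And>i. i \<in> S \<Longrightarrow> d i = d' i"
  shows "sesq S G c d = sesq S G' c' d'"
  using assms by (simp add: sesq_def)

lemma psd_on_cong:
  assumes "\<And>i j. i \<in> S \<Longrightarrow> j \<in> S \<Longrightarrow> G i j = G' i j"
  shows "psd_on S G \<longleftrightarrow> psd_on S G'"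
proof -
  have "sesq S G c c = sesq S G' c c" for c by (rule sesq_cong) (use assms in auto)
  with assms show ?thesis by (simp add: psd_on_def)
qed

lemma psd_on_subset:
  fixes S :: "'i set"
  assumes psd: "psd_on S G" and sub: "R \<subseteq> S" and fin: "finite S"
  shows "psd_on R G"
  unfolding psd_on_def
proof (intro conjI ballI allI)
  show "G j i = cnj (G i j)" if "i \<in> R" "j \<in> R" for i j
    using psd sub that unfolding psd_on_def by blast
  fix c :: "'i \<Rightarrow> complex"
  let ?c = "\<lambda>i. if i \<in> R then c i else 0"
  have "sesq S G ?c ?c = (\<Sum>i\<in>S. if i \<in> R then \<Sum>j\<in>S. if j \<in> R then c i * cnj (c j) * G i j else 0 else 0)"
    unfolding sesq_def by (auto intro!: sum.cong)
  also have "\<dots> = sesq R G c c"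
    unfolding sesq_def using fin sub by (simp add: sum.If_cases Int_absorb1)
  finally show "0 \<le> Re (sesq R G c c)"
    using psd unfolding psd_on_def by metis
qed

section \<open>Gram-Schmidt orthonormalization for possibly degenerate forms\<close>

definition point :: "'i \<Rightarrow> 'i \<Rightarrow> complex" where
  "point i = (\<lambda>j. of_bool (j = i))"

text \<open>The component of the i-th vector orthogonal to \<open>c 0\<close>, ...,
  \<open>c (r - 1)\<close>. Vectors are represented by coefficient functions, and a singular G gives
  nonzero functions of norm zero; equality of vectors therefore appears as a residual of norm
  zero.\<close>

definition gs_residual ::
    "'i set \<Rightarrow> ('i \<Rightarrow> 'i \<Rightarrow> complex) \<Rightarrow> nat \<Rightarrow> (nat \<Rightarrow> 'i \<Rightarrow> complex) \<Rightarrow> 'i \<Rightarrow> 'i \<Rightarrow> complex" where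
  "gs_residual S G r c i = (\<lambda>j. point i j - (\<Sum>k<r. sesq S G (point i) (c k) * c k j))"

lemma sum_point: "finite S \<Longrightarrow> i \<in> S \<Longrightarrow> (\<Sum>j\<in>S. point i j * f j) = f i"
proof -
  assume "finite S" "i \<in> S"
  moreover have "(\<Sum>j\<in>S. point i j * f j) = (\<Sum>j\<in>S. if j = i then f i else 0)"
    by (intro sum.cong) (auto simp: point_def)
  ultimately show ?thesis by simp
qed

lemma sesq_points:
  assumes "finite S" "i \<in> S" "j \<in> S"
  shows "sesq S G (point i) (point j) = G i j"
proof -
  have "sesq S G (point i) (point j) = (\<Sum>k\<in>S. point i k * (\<Sum>l\<in>S. point j l * G k l))"
    unfolding sesq_def sum_distrib_left by (intro sum.cong) (auto simp: point_def)
  with assms show ?thesis by (simp add: sum_point)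
qed

context
  fixes S :: "'i set" and G
  assumes psd: "psd_on S G"
begin

lemma sesq_hermitian: "sesq S G d c = cnj (sesq S G c d)"
proof -
  have "sesq S G d c = (\<Sum>j\<in>S. \<Sum>i\<in>S. d i * cnj (c j) * G i j)"
    unfolding sesq_def by (rule sum.swap)
  also have "\<dots> = (\<Sum>j\<in>S. \<Sum>i\<in>S. cnj (c j * cnj (d i) * G j i))"
  proof (intro sum.cong refl)
    fix i j assume "i \<in> S" "j \<in> S"
    with psd have "G i j = cnj (G j i)" unfolding psd_on_def by blast
    then show "d i * cnj (c j) * G i j = cnj (c j * cnj (d i) * G j i)" by simp
  qed
  finally show ?thesis by (simp add: sesq_def)
qed

lemma sesq_self: "sesq S G c c = of_real (Re (sesq S G c c))" "0 \<le> Re (sesq S G c c)"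
proof -
  have "Im (sesq S G c c) = - Im (sesq S G c c)"
    by (subst sesq_hermitian) simp
  then show "sesq S G c c = of_real (Re (sesq S G c c))" by (simp add: complex_eq_iff)
  show "0 \<le> Re (sesq S G c c)" using psd unfolding psd_on_def by blast
qed

lemma sesq_diff_right: "sesq S G d (\<lambda>j. f j - g j) = sesq S G d f - sesq S G d g"
  by (simp add: sesq_hermitian[of d] sesq_diff_left)

lemma sesq_scale_right: "sesq S G d (\<lambda>j. a * f j) = cnj a * sesq S G d f"
  by (simp add: sesq_hermitian[of d] sesq_scale_left)

lemma sesq_Cauchy_Schwarz:
  "(cmod (sesq S G c d))\<^sup>2 \<le> Re (sesq S G c c) * Re (sesq S G d d)"
proof -
  define a b z where "a = Re (sesq S G c c)" and "b = Re (sesq S G d d)" and "z = sesq S G c d"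
  have eqs: "sesq S G c c = of_real a" "sesq S G d d = of_real b" "sesq S G d c = cnj z"
    using sesq_self(1)[of c] sesq_self(1)[of d] sesq_hermitian[of d c]
    unfolding a_def b_def z_def by this+
  \<comment> \<open>The form is evaluated at c - s z d with s real. Putting z into the multiplier
    makes both cross terms equal to s |z|^2, which leaves a quadratic in s; for b > 0 it is minimal
    at s = 1/b.\<close>
  have nonneg: "0 \<le> a - 2 * s * (cmod z)\<^sup>2 + s\<^sup>2 * (cmod z)\<^sup>2 * b" for s
  proof -
    let ?e = "\<lambda>j. c j - (of_real s * z) * d j"
    have "sesq S G ?e ?e = of_real a - of_real s * (z * cnj z) - of_real s * (z * cnj z)
        + of_real (s\<^sup>2 * b) * (z * cnj z)"
      by (simp add: sesq_diff_left sesq_diff_right sesq_scale_left sesq_scale_right eqs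
          flip: z_def) (simp add: algebra_simps power2_eq_square)
    also have "z * cnj z = of_real ((cmod z)\<^sup>2)" by (simp add: complex_mult_cnj cmod_power2)
    finally have "sesq S G ?e ?e = of_real (a - 2 * s * (cmod z)\<^sup>2 + s\<^sup>2 * (cmod z)\<^sup>2 * b)"
      by (simp add: mult_ac)
    then have "Re (sesq S G ?e ?e) = a - 2 * s * (cmod z)\<^sup>2 + s\<^sup>2 * (cmod z)\<^sup>2 * b"
      by (simp only: Re_complex_of_real)
    with sesq_self(2)[of ?e] show ?thesis by simp
  qed
  have "0 \<le> a" "0 \<le> b" using sesq_self(2) by (simp_all add: a_def b_def)
  have "(cmod z)\<^sup>2 \<le> a * b"
  proof (cases "b = 0")
    case True
    have "cmod z = 0"
    proof (rule ccontr)
      assume "cmod z \<noteq> 0"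
      \<comment> \<open>For b = 0 the expression is affine in s, and this s makes it equal to
        -1.\<close>
      with nonneg[of "(a + 1) / (2 * (cmod z)\<^sup>2)"] True show False by (simp add: field_simps)
    qed
    with True show ?thesis by simp
  next
    case False
    with \<open>0 \<le> b\<close> nonneg[of "1 / b"] show ?thesis
      by (simp add: field_simps power2_eq_square)
  qed
  then show ?thesis by (simp add: a_def b_def z_def)
qed

text \<open>Cauchy-Schwarz lets a vector of norm zero be treated as zero in every pairing, even when
  G is singular.\<close>

lemma sesq_null:
  assumes "sesq S G d d = 0"
  shows "sesq S G c d = 0" and "sesq S G d c = 0"
proof -
  show "sesq S G c d = 0" using sesq_Cauchy_Schwarz[of c d] assms by simp
  then show "sesq S G d c = 0" by (simp add: sesq_hermitian[of d c])
qed

text \<open>A vector is added to the orthonormal family only if its residual has positive norm.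
  Otherwise it is skipped, so degenerate forms need no separate treatment.\<close>

lemma gram_schmidt_aux:
  assumes "finite R" and "R \<subseteq> S"
  shows "\<exists>r c. (\<forall>k<r. \<forall>l<r. sesq S G (c k) (c l) = of_bool (k = l)) \<and>
    (\<forall>i\<in>R. sesq S G (gs_residual S G r c i) (gs_residual S G r c i) = 0)"
  using assms
proof (induction rule: finite_induct)
  case empty
  show ?case by (rule exI[of _ 0]) auto
next
  case (insert s R)
  then obtain r and c :: "nat \<Rightarrow> 'i \<Rightarrow> complex" where
    orth: "\<And>k l. k < r \<Longrightarrow> l < r \<Longrightarrow> sesq S G (c k) (c l) = of_bool (k = l)" and
    res: "\<And>i. i \<in> R \<Longrightarrow> sesq S G (gs_residual S G r c i) (gs_residual S G r c i) = 0"
    by (metis subset_insertI insert_subset)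
  define d where "d = gs_residual S G r c"
  have d_orth: "sesq S G (d i) (c l) = 0" if "l < r" for i l
  proof -
    have "(\<Sum>k<r. sesq S G (point i) (c k) * sesq S G (c k) (c l))
        = (\<Sum>k<r. if k = l then sesq S G (point i) (c l) else 0)"
      using that by (intro sum.cong) (auto simp: orth)
    with that show ?thesis by (simp add: d_def gs_residual_def sesq_diff_left sesq_sum_left)
  qed
  show ?case
  proof (cases "sesq S G (d s) (d s) = 0")
    case True
    with orth res show ?thesis
      by (intro exI[of _ r] exI[of _ c]) (auto simp: d_def)
  next
    case False
    define n where "n = Re (sesq S G (d s) (d s))"
    have n: "sesq S G (d s) (d s) = of_real n" "n > 0"
      using False sesq_self[of "d s"] by (auto simp: n_def less_le)
    define c' where "c' = c(r := (\<lambda>j. of_real (1 / sqrt n) * d s j))"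
    have c'_lt: "c' k = c k" if "k < r" for k using that by (simp add: c'_def)
    have c'_r: "c' r = (\<lambda>j. of_real (1 / sqrt n) * d s j)" by (simp add: c'_def)
    have orth': "sesq S G (c' k) (c' l) = of_bool (k = l)" if "k < Suc r" "l < Suc r" for k l
    proof -
      have nn: "sesq S G (c' r) (c' r) = 1"
        using n(2) less_imp_neq[OF n(2)]
        by (simp add: c'_r sesq_scale_left sesq_scale_right n(1) flip: of_real_mult of_real_divide)
      have rk: "sesq S G (c' r) (c' k) = 0" if "k < r" for k
        unfolding c'_r c'_lt[OF that] sesq_scale_left d_orth[OF that] by simp
      have "sesq S G (c' k) (c' r) = 0" if "k < r" for k
        by (subst sesq_hermitian) (simp add: rk that)
      with that nn rk orth show ?thesis
        by (cases "k = r"; cases "l = r") (auto simp: c'_lt less_Suc_eq)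
    qed
    have "sesq S G (gs_residual S G (Suc r) c' i) (gs_residual S G (Suc r) c' i) = 0"
      if "i \<in> insert s R" for i
    proof -
      have "sesq S G (c k) (c' r) = 0" if "k < r" for k
        using orth'[of k r] that by (simp add: c'_lt)
      then have "sesq S G (point i) (c' r) = sesq S G (d i) (c' r)"
        by (simp add: d_def gs_residual_def sesq_diff_left sesq_sum_left)
      then have d'_eq: "gs_residual S G (Suc r) c' i = (\<lambda>j. d i j - sesq S G (d i) (c' r) * c' r j)"
        by (simp add: gs_residual_def d_def c'_lt diff_diff_eq)
      show ?thesis
      proof (cases "i = s")
        case True
        have ds: "sesq S G (d s) (c' r) = of_real (sqrt n)"
          using less_imp_le[OF n(2)] by (simp add: c'_r sesq_scale_right n(1) real_div_sqrt del: of_real_divide flip: of_real_mult)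
        have "gs_residual S G (Suc r) c' i = (\<lambda>j. 0)"
          unfolding d'_eq unfolding True ds unfolding c'_r using n(2) by simp
        then show ?thesis by (simp add: sesq_def)
      next
        case False
        \<comment> \<open>An earlier residual has norm zero, hence is orthogonal to the new vector
          and does not change.\<close>
        with that have "sesq S G (d i) (d i) = 0" using res by (auto simp: d_def)
        then show ?thesis using sesq_null(2)[of "d i"] by (simp add: d'_eq)
      qed
    qed
    with orth' show ?thesis by blast
  qed
qed

lemma gram_schmidt:
  assumes "finite S"
  obtains r c where
    "\<And>k l. k < r \<Longrightarrow> l < r \<Longrightarrow> sesq S G (c k) (c l) = of_bool (k = l)"
    "\<And>i. i \<in> S \<Longrightarrow> sesq S G (gs_residual S G r c i) (gs_residual S G r c i) = 0"
  using gram_schmidt_aux[OF assms order_refl] by blast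

text \<open>The coordinates in an orthonormal family serve as L; since all residuals are null,
  Parseval's identity is exact.\<close>

lemma gram_factorization:
  assumes fin: "finite S"
  obtains r :: nat and L where "\<And>i j. i \<in> S \<Longrightarrow> j \<in> S \<Longrightarrow> G i j = (\<Sum>k<r. L i k * cnj (L j k))"
proof -
  obtain r c where
    res: "\<And>i. i \<in> S \<Longrightarrow> sesq S G (gs_residual S G r c i) (gs_residual S G r c i) = 0"
    using gram_schmidt[OF fin] by metis
  have "G i j = (\<Sum>k<r. sesq S G (point i) (c k) * cnj (sesq S G (point j) (c k)))"
    if "i \<in> S" "j \<in> S" for i j
  proof -
    have "G i j = sesq S G (point i) (point j)" using that fin by (simp add: sesq_points)
    also have "\<dots> = (\<Sum>k<r. sesq S G (point i) (c k) * sesq S G (c k) (point j))"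
      using sesq_null(2)[OF res[OF \<open>i \<in> S\<close>], of "point j"]
      by (simp add: gs_residual_def sesq_diff_left sesq_sum_left)
    finally show ?thesis by (simp add: sesq_hermitian[of _ "point j"])
  qed
  then show ?thesis by (rule that)
qed

end

section \<open>Gram kernels, Schur products and the lurking isometry\<close>

lemma sesq_gram:
  "sesq S (\<lambda>i j. \<Sum>\<alpha>\<in>A. a i \<alpha> * cnj (a j \<alpha>)) c d
     = (\<Sum>\<alpha>\<in>A. (\<Sum>i\<in>S. c i * a i \<alpha>) * cnj (\<Sum>i\<in>S. d i * a i \<alpha>))"
proof -
  have "sesq S (\<lambda>i j. \<Sum>\<alpha>\<in>A. a i \<alpha> * cnj (a j \<alpha>)) c d
      = (\<Sum>i\<in>S. \<Sum>j\<in>S. \<Sum>\<alpha>\<in>A. (c i * a i \<alpha>) * cnj (d j * a j \<alpha>))"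
    unfolding sesq_def by (simp add: sum_distrib_left mult_ac)
  also have "\<dots> = (\<Sum>\<alpha>\<in>A. \<Sum>i\<in>S. \<Sum>j\<in>S. (c i * a i \<alpha>) * cnj (d j * a j \<alpha>))"
    by (subst (2) sum.swap, subst sum.swap) (rule refl)
  finally show ?thesis by (simp add: sum_product)
qed

lemma Re_mult_cnj_self: "Re (z * cnj z) = (cmod z)\<^sup>2"
  by (simp add: complex_mult_cnj cmod_power2)

lemma psd_on_gram: "psd_on S (\<lambda>i j. \<Sum>\<alpha>\<in>A. a i \<alpha> * cnj (a j \<alpha>))"
  unfolding psd_on_def sesq_gram Re_sum Re_mult_cnj_self
  by (auto intro!: sum.cong sum_nonneg)

text \<open>The product of two Gram kernels is the Gram kernel of the tensor products of their
  vectors.\<close>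

lemma psd_on_schur_product:
  assumes "psd_on S G" "psd_on S G'" "finite S"
  shows "psd_on S (\<lambda>i j. G i j * G' i j)"
proof -
  obtain r :: nat and L where L: "\<And>i j. i \<in> S \<Longrightarrow> j \<in> S \<Longrightarrow> G i j = (\<Sum>k<r. L i k * cnj (L j k))"
    using gram_factorization[OF assms(1,3)] by metis
  obtain r' :: nat and L' where L': "\<And>i j. i \<in> S \<Longrightarrow> j \<in> S \<Longrightarrow> G' i j = (\<Sum>k<r'. L' i k * cnj (L' j k))"
    using gram_factorization[OF assms(2,3)] by metis
  have "G i j * G' i j = (\<Sum>(k, k')\<in>{..<r} \<times> {..<r'}. (L i k * L' i k') * cnj (L j k * L' j k'))"
    if "i \<in> S" "j \<in> S" for i j
    unfolding L[OF that] L'[OF that] sum_product sum.cartesian_product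
    by (simp add: split_beta mult_ac)
  then have "psd_on S (\<lambda>i j. G i j * G' i j) \<longleftrightarrow>
      psd_on S (\<lambda>i j. \<Sum>k\<in>{..<r} \<times> {..<r'}. (\<lambda>(k, k'). L i k * L' i k') k * cnj ((\<lambda>(k, k'). L j k * L' j k') k))"
    by (intro psd_on_cong) (simp add: split_beta)
  then show ?thesis by (simp only: psd_on_gram)
qed

lemma psd_on_add:
  assumes "psd_on S G" "psd_on S G'"
  shows "psd_on S (\<lambda>i j. G i j + G' i j)"
proof -
  have "sesq S (\<lambda>i j. G i j + G' i j) c c = sesq S G c c + sesq S G' c c" for c
    by (simp add: sesq_def algebra_simps sum.distrib)
  moreover have "G j i + G' j i = cnj (G i j + G' i j)" if "i \<in> S" "j \<in> S" for i j
    using assms that unfolding psd_on_def by (metis complex_cnj_add)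
  moreover have "0 \<le> Re (sesq S G c c)" "0 \<le> Re (sesq S G' c c)" for c
    using assms unfolding psd_on_def by blast+
  ultimately show ?thesis unfolding psd_on_def by simp
qed

text \<open>Pulling back Gram factors also works for a non-injective f, such as the projection of
  pairs of a point and an index to the point.\<close>

lemma psd_on_reindex:
  assumes psd: "psd_on S G" and "finite S" "finite R" "f ` R \<subseteq> S"
  shows "psd_on R (\<lambda>i j. G (f i) (f j))"
proof -
  obtain r :: nat and L where L: "\<And>i j. i \<in> S \<Longrightarrow> j \<in> S \<Longrightarrow> G i j = (\<Sum>k<r. L i k * cnj (L j k))"
    using gram_factorization[OF assms(1,2)] by metis
  have "psd_on R (\<lambda>i j. G (f i) (f j)) \<longleftrightarrow> psd_on R (\<lambda>i j. \<Sum>k<r. L (f i) k * cnj (L (f j) k))"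
    using assms(4) by (intro psd_on_cong) (auto intro!: L)
  then show ?thesis by (simp only: psd_on_gram)
qed

text \<open>Equal Gram matrices make the assignment of b_j to a_j a well-defined isometry between
  the two spans. Both families induce the same form on coefficients, so one Gram-Schmidt run
  orthonormalizes them simultaneously, giving bases u and w of the spans.\<close>

lemma contraction_of_gram_eq:
  fixes a :: "'i \<Rightarrow> 'a \<Rightarrow> complex" and b :: "'i \<Rightarrow> 'b \<Rightarrow> complex"
  assumes fin: "finite J" "finite A" "finite B"
    and gram: "\<And>i j. i \<in> J \<Longrightarrow> j \<in> J \<Longrightarrow>
      (\<Sum>\<alpha>\<in>A. a i \<alpha> * cnj (a j \<alpha>)) = (\<Sum>\<beta>\<in>B. b i \<beta> * cnj (b j \<beta>))"
  obtains W :: "'b \<Rightarrow> 'a \<Rightarrow> complex" where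
    "\<And>j \<beta>. j \<in> J \<Longrightarrow> \<beta> \<in> B \<Longrightarrow> (\<Sum>\<alpha>\<in>A. W \<beta> \<alpha> * a j \<alpha>) = b j \<beta>"
    "\<And>x. (\<Sum>\<beta>\<in>B. (cmod (\<Sum>\<alpha>\<in>A. W \<beta> \<alpha> * x \<alpha>))\<^sup>2) \<le> (\<Sum>\<alpha>\<in>A. (cmod (x \<alpha>))\<^sup>2)"
proof -
  define G where "G = (\<lambda>i j. \<Sum>\<alpha>\<in>A. a i \<alpha> * cnj (a j \<alpha>))"
  have psd: "psd_on J G" unfolding G_def by (rule psd_on_gram)
  have Ga: "sesq J G c d = (\<Sum>\<alpha>\<in>A. (\<Sum>i\<in>J. c i * a i \<alpha>) * cnj (\<Sum>i\<in>J. d i * a i \<alpha>))" for c d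
    unfolding G_def by (rule sesq_gram)
  have Gb: "sesq J G c d = (\<Sum>\<beta>\<in>B. (\<Sum>i\<in>J. c i * b i \<beta>) * cnj (\<Sum>i\<in>J. d i * b i \<beta>))" for c d
    unfolding sesq_gram[symmetric] by (rule sesq_cong) (auto simp: G_def gram)
  obtain r c where
    orth: "\<And>k l. k < r \<Longrightarrow> l < r \<Longrightarrow> sesq J G (c k) (c l) = of_bool (k = l)" and
    res: "\<And>i. i \<in> J \<Longrightarrow> sesq J G (gs_residual J G r c i) (gs_residual J G r c i) = 0"
    using gram_schmidt[OF psd fin(1)] by metis
  define u where "u = (\<lambda>k \<alpha>. \<Sum>i\<in>J. c k i * a i \<alpha>)"
  define w where "w = (\<lambda>k \<beta>. \<Sum>i\<in>J. c k i * b i \<beta>)"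
  have orth_u: "(\<Sum>\<alpha>\<in>A. u k \<alpha> * cnj (u l \<alpha>)) = of_bool (k = l)" if "k < r" "l < r" for k l
    using orth[OF that] by (simp add: Ga u_def)
  have orth_w: "(\<Sum>\<beta>\<in>B. w k \<beta> * cnj (w l \<beta>)) = of_bool (k = l)" if "k < r" "l < r" for k l
    using orth[OF that] by (simp add: Gb w_def)
  \<comment> \<open>W sends u_k to w_k and vanishes on the orthogonal complement of the u_k.\<close>
  define W where "W = (\<lambda>\<beta> \<alpha>. \<Sum>k<r. w k \<beta> * cnj (u k \<alpha>))"
  define t where "t = (\<lambda>x k. \<Sum>\<alpha>\<in>A. cnj (u k \<alpha>) * x \<alpha>)"
  have W: "(\<Sum>\<alpha>\<in>A. W \<beta> \<alpha> * x \<alpha>) = (\<Sum>k<r. t x k * w k \<beta>)" for x \<beta>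
    unfolding W_def t_def sum_distrib_right by (subst sum.swap) (simp add: mult_ac)
  show ?thesis
  proof
    fix j \<beta> assume j: "j \<in> J" and \<beta>: "\<beta> \<in> B"
    let ?d = "gs_residual J G r c j"
    \<comment> \<open>Computed with b, the norm of a residual is a sum of squares. Its nullity means
      that b_j equals its expansion in the w_k, coordinate by coordinate.\<close>
    have "(\<Sum>\<beta>\<in>B. (cmod (\<Sum>i\<in>J. ?d i * b i \<beta>))\<^sup>2) = Re (sesq J G ?d ?d)"
      unfolding Gb Re_sum Re_mult_cnj_self ..
    with res[OF j] fin(3) have "(\<Sum>i\<in>J. ?d i * b i \<beta>) = 0" if "\<beta> \<in> B" for \<beta>
      using that by (auto simp: sum_nonneg_eq_0_iff)
    moreover have "(\<Sum>i\<in>J. ?d i * b i \<beta>) = b j \<beta> - (\<Sum>k<r. sesq J G (point j) (c k) * w k \<beta>)" for \<beta>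
    proof -
      have "(\<Sum>i\<in>J. (\<Sum>k<r. sesq J G (point j) (c k) * c k i) * b i \<beta>)
          = (\<Sum>k<r. sesq J G (point j) (c k) * w k \<beta>)"
        unfolding w_def sum_distrib_left sum_distrib_right
        by (subst sum.swap) (simp add: mult_ac)
      then show ?thesis using j by (simp add: fin gs_residual_def left_diff_distrib sum_subtractf sum_point)
    qed
    moreover have "sesq J G (point j) (c k) = t (a j) k" for k
      using j by (simp add: fin Ga sum_point t_def u_def mult.commute)
    ultimately show "(\<Sum>\<alpha>\<in>A. W \<beta> \<alpha> * a j \<alpha>) = b j \<beta>"
      using \<beta> by (simp add: W)
  next
    fix x
    have sum_delta: "(\<Sum>l<r. of_bool (k = l) * f l) = f k" if "k < r" for k and f :: "nat \<Rightarrow> complex"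
    proof -
      have "(\<Sum>l<r. of_bool (k = l) * f l) = (\<Sum>l<r. if l = k then f k else 0)"
        by (intro sum.cong) auto
      with that show ?thesis by simp
    qed
    let ?n = "\<Sum>k<r. t x k * cnj (t x k)"
    have norm_comb: "(\<Sum>\<gamma>\<in>C. (\<Sum>k<r. f k * v k \<gamma>) * cnj (\<Sum>k<r. f k * v k \<gamma>)) = (\<Sum>k<r. f k * cnj (f k))"
      if "\<And>k l. k < r \<Longrightarrow> l < r \<Longrightarrow> (\<Sum>\<gamma>\<in>C. v k \<gamma> * cnj (v l \<gamma>)) = of_bool (k = l)"
      for f :: "nat \<Rightarrow> complex" and v :: "nat \<Rightarrow> 'z \<Rightarrow> complex" and C
    proof -
      have "(\<Sum>\<gamma>\<in>C. (\<Sum>k<r. f k * v k \<gamma>) * cnj (\<Sum>k<r. f k * v k \<gamma>))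
          = sesq {..<r} (\<lambda>k l. \<Sum>\<gamma>\<in>C. v k \<gamma> * cnj (v l \<gamma>)) f f"
        by (simp add: sesq_gram)
      also have "\<dots> = (\<Sum>k<r. f k * (\<Sum>l<r. of_bool (k = l) * cnj (f l)))"
        unfolding sesq_def
        by (subst sum_distrib_left, intro sum.cong refl) (simp add: that)
      also have "\<dots> = (\<Sum>k<r. f k * cnj (f k))"
        by (intro sum.cong refl) (simp add: sum_delta)
      finally show ?thesis .
    qed
    have "(\<Sum>\<beta>\<in>B. (cmod (\<Sum>\<alpha>\<in>A. W \<beta> \<alpha> * x \<alpha>))\<^sup>2)
        = Re (\<Sum>\<beta>\<in>B. (\<Sum>k<r. t x k * w k \<beta>) * cnj (\<Sum>k<r. t x k * w k \<beta>))"
      unfolding W Re_sum Re_mult_cnj_self ..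
    also have "\<dots> = Re ?n" using norm_comb[OF orth_w] by simp
    also have "\<dots> \<le> (\<Sum>\<alpha>\<in>A. (cmod (x \<alpha>))\<^sup>2)"
    proof -
      \<comment> \<open>The orthogonal projection of x to the span of the u_k; expanding |x - y|^2
        gives Bessel's inequality.\<close>
      define y where "y = (\<lambda>\<alpha>. \<Sum>k<r. t x k * u k \<alpha>)"
      have yy: "(\<Sum>\<alpha>\<in>A. y \<alpha> * cnj (y \<alpha>)) = ?n"
        unfolding y_def by (rule norm_comb[OF orth_u])
      have xy: "(\<Sum>\<alpha>\<in>A. x \<alpha> * cnj (y \<alpha>)) = ?n"
      proof -
        have "(\<Sum>\<alpha>\<in>A. x \<alpha> * cnj (y \<alpha>)) = (\<Sum>\<alpha>\<in>A. \<Sum>k<r. cnj (t x k) * (cnj (u k \<alpha>) * x \<alpha>))"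
          unfolding y_def by (simp add: sum_distrib_left mult_ac)
        also have "\<dots> = (\<Sum>k<r. cnj (t x k) * t x k)"
          by (subst sum.swap) (simp add: t_def sum_distrib_left)
        finally show ?thesis by (simp add: mult.commute)
      qed
      have "0 \<le> (\<Sum>\<alpha>\<in>A. (cmod (x \<alpha> - y \<alpha>))\<^sup>2)" by (intro sum_nonneg) simp
      also have "\<dots> = Re (\<Sum>\<alpha>\<in>A. (x \<alpha> - y \<alpha>) * cnj (x \<alpha> - y \<alpha>))"
        unfolding Re_sum Re_mult_cnj_self ..
      also have "(\<Sum>\<alpha>\<in>A. (x \<alpha> - y \<alpha>) * cnj (x \<alpha> - y \<alpha>)) =
          (\<Sum>\<alpha>\<in>A. x \<alpha> * cnj (x \<alpha>)) - (\<Sum>\<alpha>\<in>A. x \<alpha> * cnj (y \<alpha>)) - cnj (\<Sum>\<alpha>\<in>A. x \<alpha> * cnj (y \<alpha>)) + ?n"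
        unfolding yy[symmetric] by (simp add: algebra_simps sum.distrib sum_subtractf)
      also have "Re \<dots> = (\<Sum>\<alpha>\<in>A. (cmod (x \<alpha>))\<^sup>2) - Re ?n"
      proof -
        have "Re (p - n - cnj n + n) = Re p - Re n" for p n by simp
        then show ?thesis unfolding xy by (simp only: Re_sum Re_mult_cnj_self)
      qed
      finally show ?thesis by simp
    qed
    finally show "(\<Sum>\<beta>\<in>B. (cmod (\<Sum>\<alpha>\<in>A. W \<beta> \<alpha> * x \<alpha>))\<^sup>2) \<le> (\<Sum>\<alpha>\<in>A. (cmod (x \<alpha>))\<^sup>2)" .
  qed
qed

section \<open>Pick interpolation\<close>

text \<open>A kernel vector of I - R would be fixed by R, which strictly shrinks nonzero vectors; a
  square matrix with trivial kernel is invertible. The constant \<theta> bounds squared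
  norms.\<close>

lemma fixed_point_of_contraction:
  fixes R :: "nat \<Rightarrow> nat \<Rightarrow> complex" and b :: "nat \<Rightarrow> complex"
  assumes contr: "\<And>x. (\<Sum>k<r. (cmod (\<Sum>l<r. R k l * x l))\<^sup>2) \<le> \<theta> * (\<Sum>k<r. (cmod (x k))\<^sup>2)"
    and "\<theta> < 1"
  obtains x where "\<And>k. k < r \<Longrightarrow> x k = b k + (\<Sum>l<r. R k l * x l)"
proof -
  define A where "A = mat r r (\<lambda>(k, l). of_bool (k = l) - R k l)"
  have A: "A \<in> carrier_mat r r" by (simp add: A_def)
  have A_mult: "(A *\<^sub>v v) $ k = v $ k - (\<Sum>l<r. R k l * v $ l)"
    if "v \<in> carrier_vec r" "k < r" for v k
  proof -
    have "(A *\<^sub>v v) $ k = (\<Sum>l<r. (of_bool (k = l) - R k l) * v $ l)"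
      using that by (simp add: A_def scalar_prod_def atLeast0LessThan)
    also have "\<dots> = (\<Sum>l<r. point k l * v $ l) - (\<Sum>l<r. R k l * v $ l)"
      by (simp add: left_diff_distrib sum_subtractf point_def eq_commute)
    finally show ?thesis using that by (simp add: sum_point)
  qed
  have "det A \<noteq> 0"
  proof
    assume "det A = 0"
    then obtain v where v: "v \<in> carrier_vec r" "v \<noteq> 0\<^sub>v r" "A *\<^sub>v v = 0\<^sub>v r"
      using det_0_iff_vec_prod_zero_field[OF A] by blast
    have fixed: "(\<Sum>l<r. R k l * v $ l) = v $ k" if "k < r" for k
      using A_mult[OF v(1) that] v(3) that by simp
    let ?n = "\<Sum>k<r. (cmod (v $ k))\<^sup>2"
    have "?n \<le> \<theta> * ?n" using contr[of "\<lambda>k. v $ k"] by (simp add: fixed)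
    then have "(1 - \<theta>) * ?n \<le> 0" by (simp add: algebra_simps)
    moreover have "0 \<le> ?n" by (intro sum_nonneg) simp
    ultimately have "?n = 0" using \<open>\<theta> < 1\<close> by (simp add: mult_le_0_iff)
    then have "v $ k = 0" if "k < r" for k using that by (simp add: sum_nonneg_eq_0_iff)
    with v show False by (auto simp: vec_eq_iff)
  qed
  from det_non_zero_imp_unit[OF A this, of "()"]
  obtain B where B: "B \<in> carrier_mat r r" "A * B = 1\<^sub>m r"
    by (auto simp: Units_def ring_mat_def)
  define x where "x = B *\<^sub>v vec r b"
  have x: "x \<in> carrier_vec r" using B(1) by (auto simp: x_def)
  have "A *\<^sub>v x = vec r b"
    using A B by (simp add: x_def flip: assoc_mult_mat_vec[OF A B(1)])
  then have "x $ k = b k + (\<Sum>l<r. R k l * x $ l)" if "k < r" for k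
    using A_mult[OF x that] that by (simp add: algebra_simps)
  then show ?thesis by (rule that)
qed

text \<open>The kernel \<open>k(x, y) (s I - m(x) m(y)\<^sup>*)\<close>, whose entries are indexed by pairs of a point
  and a row of the matrix-valued function \<open>m\<close> with \<open>q\<close> columns.\<close>

definition pick_kernel ::
    "('x \<Rightarrow> 'x \<Rightarrow> complex) \<Rightarrow> complex \<Rightarrow> nat \<Rightarrow> ('x \<Rightarrow> nat \<Rightarrow> nat \<Rightarrow> complex) \<Rightarrow> 'x \<times> nat \<Rightarrow> 'x \<times> nat \<Rightarrow> complex" where
  "pick_kernel k s q m i j = k (fst i) (fst j) *
     (s * of_bool (snd i = snd j) - (\<Sum>l<q. m (fst i) (snd i) l * cnj (m (fst j) (snd j) l)))"

text \<open>The direct sum of the unit vector e_i and the tensor product of f and u: the input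
  vector of the colligation, formed from a row index, a point of the ball and a state u.\<close>

definition row_tensor :: "('v \<Rightarrow> complex) \<Rightarrow> nat \<Rightarrow> (nat \<Rightarrow> complex) \<Rightarrow> nat + 'v \<times> nat \<Rightarrow> complex" where
  "row_tensor f i u = case_sum (point i) (\<lambda>(v, k). f v * u k)"

lemma row_tensor_gram:
  assumes "finite V" "i < p"
  shows "(\<Sum>\<alpha>\<in>{..<p} <+> V \<times> {..<r}. row_tensor f i u \<alpha> * cnj (row_tensor g j w \<alpha>))
    = of_bool (i = j) + (\<Sum>v\<in>V. f v * cnj (g v)) * (\<Sum>k<r. u k * cnj (w k))"
proof -
  have "(\<Sum>l<p. point i l * cnj (point j l)) = of_bool (i = j)"
    using assms by (simp add: sum_point) (simp add: point_def)
  then show ?thesis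
    using assms by (simp add: sum.Plus row_tensor_def sum_product sum.cartesian_product split_beta mult_ac)
qed

text \<open>The sufficiency half of the McCullough--Quiggin theorem on a finite set. From
  \<open>I - m(x) m(y)\<^sup>* = (1 - \<langle>\<phi>(x), \<phi>(y)\<rangle>) \<langle>L(x), L(y)\<rangle>\<close> one reads off two families with equal Gram
  matrices; the contraction \<open>W\<close> matching them is the colligation of a transfer function that
  realizes \<open>m\<close> on \<open>Y\<close> and makes sense on all of \<open>X\<close>.\<close>

lemma pick_extension:
  fixes k :: "'x \<Rightarrow> 'x \<Rightarrow> complex" and \<phi> :: "'x \<Rightarrow> 'v \<Rightarrow> complex" and m :: "'x \<Rightarrow> nat \<Rightarrow> nat \<Rightarrow> complex"
  assumes X: "finite X" and V: "finite V" and YX: "Y \<subseteq> X"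
    and ball: "\<And>x. x \<in> X \<Longrightarrow> (\<Sum>v\<in>V. (cmod (\<phi> x v))\<^sup>2) < 1"
    and k: "\<And>x y. x \<in> X \<Longrightarrow> y \<in> X \<Longrightarrow> k x y * (1 - (\<Sum>v\<in>V. \<phi> x v * cnj (\<phi> y v))) = 1"
    and k_psd: "psd_on X k"
    and psd: "psd_on (Y \<times> {..<p}) (pick_kernel k 1 q m)"
  obtains m' where "\<And>y i l. y \<in> Y \<Longrightarrow> i < p \<Longrightarrow> l < q \<Longrightarrow> m' y i l = m y i l"
    and "psd_on (X \<times> {..<p}) (pick_kernel k 1 q m')"
proof -
  have Y: "finite Y" using X YX by (rule finite_subset[rotated])
  define J where "J = Y \<times> {..<p}"
  have J: "finite J" using Y by (simp add: J_def)
  obtain r :: nat and L where L: "\<And>i j. i \<in> J \<Longrightarrow> j \<in> J \<Longrightarrow>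
      pick_kernel k 1 q m i j = (\<Sum>h<r. L i h * cnj (L j h))"
    using gram_factorization[OF psd[folded J_def] J] by metis
  define A where "A = {..<p} <+> V \<times> {..<r}"
  define B where "B = {..<q} <+> {..<r}"
  have AB: "finite A" "finite B" using V by (simp_all add: A_def B_def)
  have B_gram: "(\<Sum>\<beta>\<in>B. case_sum f u \<beta> * cnj (case_sum g w \<beta>))
      = (\<Sum>l<q. f l * cnj (g l)) + (\<Sum>h<r. u h * cnj (w h))" for f g u w :: "nat \<Rightarrow> complex"
    by (simp add: B_def sum.Plus)
  have gram: "(\<Sum>\<alpha>\<in>A. row_tensor (\<phi> (fst i)) (snd i) (L i) \<alpha> * cnj (row_tensor (\<phi> (fst j)) (snd j) (L j) \<alpha>))
      = (\<Sum>\<beta>\<in>B. case_sum (m (fst i) (snd i)) (L i) \<beta> * cnj (case_sum (m (fst j) (snd j)) (L j) \<beta>))"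
    if "i \<in> J" "j \<in> J" for i j
  proof -
    define g where "g = (\<Sum>v\<in>V. \<phi> (fst i) v * cnj (\<phi> (fst j) v))"
    define M where "M = (\<Sum>l<q. m (fst i) (snd i) l * cnj (m (fst j) (snd j) l))"
    have ij: "fst i \<in> X" "fst j \<in> X" "snd i < p" using that YX by (auto simp: J_def)
    have kg: "k (fst i) (fst j) * (1 - g) = 1" using k[OF ij(1,2)] by (simp add: g_def)
    \<comment> \<open>Multiplying the factorized Pick kernel by 1 - g cancels k. Moving the negative
      terms to the other side then leaves a Gram kernel on each side.\<close>
    have "(1 - g) * (\<Sum>h<r. L i h * cnj (L j h)) = (k (fst i) (fst j) * (1 - g)) * (of_bool (snd i = snd j) - M)"
      by (simp add: pick_kernel_def M_def flip: L[OF that])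
    then have "of_bool (snd i = snd j) + g * (\<Sum>h<r. L i h * cnj (L j h)) = M + (\<Sum>h<r. L i h * cnj (L j h))"
      unfolding kg by (simp add: algebra_simps)
    then show ?thesis
      unfolding A_def row_tensor_gram[OF V ij(3)] B_gram by (simp add: g_def M_def)
  qed
  obtain W where W: "\<And>j \<beta>. j \<in> J \<Longrightarrow> \<beta> \<in> B \<Longrightarrow>
      (\<Sum>\<alpha>\<in>A. W \<beta> \<alpha> * row_tensor (\<phi> (fst j)) (snd j) (L j) \<alpha>) = case_sum (m (fst j) (snd j)) (L j) \<beta>"
    and W_contr: "\<And>x. (\<Sum>\<beta>\<in>B. (cmod (\<Sum>\<alpha>\<in>A. W \<beta> \<alpha> * x \<alpha>))\<^sup>2) \<le> (\<Sum>\<alpha>\<in>A. (cmod (x \<alpha>))\<^sup>2)"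
    by (rule contraction_of_gram_eq[OF J AB, where
          a = "\<lambda>j. row_tensor (\<phi> (fst j)) (snd j) (L j)" and
          b = "\<lambda>j. case_sum (m (fst j) (snd j)) (L j)"]) (use gram in blast)+
  \<comment> \<open>The state equation at the pair j. Over Y the known factor L solves it and is
    chosen outright, so that the transfer function returns m there; at the other points a solution
    comes from the strict contraction R, the state block of W applied to \<phi>.\<close>
  have "\<exists>u. (\<forall>h<r. u h = (\<Sum>\<alpha>\<in>A. W (Inr h) \<alpha> * row_tensor (\<phi> (fst j)) (snd j) u \<alpha>)) \<and> (fst j \<in> Y \<longrightarrow> u = L j)"
    if j: "j \<in> X \<times> {..<p}" for j
  proof (cases "fst j \<in> Y")
    case True
    with j have "j \<in> J" by (auto simp: J_def)
    moreover have "Inr h \<in> B" if "h < r" for h using that by (auto simp: B_def)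
    ultimately show ?thesis using W by (intro exI[of _ "L j"]) simp
  next
    case False
    define f where "f = \<phi> (fst j)"
    define R where "R = (\<lambda>h l. \<Sum>v\<in>V. W (Inr h) (Inr (v, l)) * f v)"
    define c where "c = (\<lambda>h. \<Sum>i<p. W (Inr h) (Inl i) * point (snd j) i)"
    have inr: "(\<Sum>x\<in>V \<times> {..<r}. W (Inr h) (Inr x) * (case x of (v, l) \<Rightarrow> f v * u l)) = (\<Sum>l<r. R h l * u l)" for h u
    proof -
      have "(\<Sum>x\<in>V \<times> {..<r}. W (Inr h) (Inr x) * (case x of (v, l) \<Rightarrow> f v * u l))
          = (\<Sum>v\<in>V. \<Sum>l<r. W (Inr h) (Inr (v, l)) * f v * u l)"
        by (simp add: sum.cartesian_product split_beta mult_ac)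
      also have "\<dots> = (\<Sum>l<r. R h l * u l)"
        by (subst sum.swap) (simp add: R_def sum_distrib_right)
      finally show ?thesis .
    qed
    have "(\<Sum>h<r. (cmod (\<Sum>l<r. R h l * x l))\<^sup>2) \<le> (\<Sum>v\<in>V. (cmod (f v))\<^sup>2) * (\<Sum>h<r. (cmod (x h))\<^sup>2)" for x
    proof -
      \<comment> \<open>Input with first component 0 and second component f tensored with x.
        Dropping the output coordinates \<open>Inl\<close> from the bound on W shows that R shrinks
        squared norms by the factor |f|^2 < 1.\<close>
      define y where "y = case_sum (\<lambda>_::nat. 0) (\<lambda>(v, l). f v * x l)"
      have Wy: "(\<Sum>\<alpha>\<in>A. W (Inr h) \<alpha> * y \<alpha>) = (\<Sum>l<r. R h l * x l)" for h
        using V by (simp add: A_def sum.Plus y_def inr)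
      have "(\<Sum>h<r. (cmod (\<Sum>l<r. R h l * x l))\<^sup>2) \<le> (\<Sum>\<beta>\<in>B. (cmod (\<Sum>\<alpha>\<in>A. W \<beta> \<alpha> * y \<alpha>))\<^sup>2)"
        by (simp add: B_def sum.Plus Wy sum_nonneg)
      also have "\<dots> \<le> (\<Sum>\<alpha>\<in>A. (cmod (y \<alpha>))\<^sup>2)" by (rule W_contr)
      also have "\<dots> = (\<Sum>v\<in>V. (cmod (f v))\<^sup>2) * (\<Sum>h<r. (cmod (x h))\<^sup>2)"
        using V by (simp add: A_def sum.Plus y_def sum_product sum.cartesian_product split_beta
            norm_mult power_mult_distrib)
      finally show ?thesis .
    qed
    moreover have "(\<Sum>v\<in>V. (cmod (f v))\<^sup>2) < 1" using j by (auto simp: f_def intro: ball)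
    ultimately obtain u where "\<And>h. h < r \<Longrightarrow> u h = c h + (\<Sum>l<r. R h l * u l)"
      using fixed_point_of_contraction by blast
    moreover have "(\<Sum>\<alpha>\<in>A. W (Inr h) \<alpha> * row_tensor f (snd j) u \<alpha>) = c h + (\<Sum>l<r. R h l * u l)" for h
      using V by (simp add: A_def sum.Plus row_tensor_def c_def inr)
    ultimately show ?thesis using False unfolding f_def by metis
  qed
  then obtain u where u_all: "\<forall>j\<in>X \<times> {..<p}.
      (\<forall>h<r. u j h = (\<Sum>\<alpha>\<in>A. W (Inr h) \<alpha> * row_tensor (\<phi> (fst j)) (snd j) (u j) \<alpha>)) \<and>
      (fst j \<in> Y \<longrightarrow> u j = L j)"
    by (rule bchoice[OF ballI, THEN exE])
  have u: "u j h = (\<Sum>\<alpha>\<in>A. W (Inr h) \<alpha> * row_tensor (\<phi> (fst j)) (snd j) (u j) \<alpha>)"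
    if "j \<in> X \<times> {..<p}" "h < r" for j h
    using u_all that by blast
  have uY: "u j = L j" if "j \<in> J" for j
    using u_all that YX by (auto simp: J_def)
  define av where "av = (\<lambda>j. row_tensor (\<phi> (fst j)) (snd j) (u j))"
  \<comment> \<open>The output part of the colligation, evaluated at the solved states.\<close>
  define m' where "m' = (\<lambda>x i l. \<Sum>\<alpha>\<in>A. W (Inl l) \<alpha> * av (x, i) \<alpha>)"
  define bv where "bv = (\<lambda>j. case_sum (m' (fst j) (snd j)) (u j))"
  have W_av: "(\<Sum>\<alpha>\<in>A. W \<beta> \<alpha> * av j \<alpha>) = bv j \<beta>" if "j \<in> X \<times> {..<p}" "\<beta> \<in> B" for j \<beta>
    using that u[OF that(1)] by (auto simp: bv_def m'_def av_def B_def)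
  \<comment> \<open>The defect kernel: inner products of the inputs minus those of their images
    under W. It is positive because W is a contraction.\<close>
  define P where "P = (\<lambda>i j. (\<Sum>\<alpha>\<in>A. av i \<alpha> * cnj (av j \<alpha>)) - (\<Sum>\<beta>\<in>B. bv i \<beta> * cnj (bv j \<beta>)))"
  have P_psd: "psd_on (X \<times> {..<p}) P"
    unfolding psd_on_def
  proof (intro conjI ballI allI)
    show "P j i = cnj (P i j)" for i j by (simp add: P_def mult.commute)
    fix c
    define x where "x = (\<lambda>\<alpha>. \<Sum>j\<in>X \<times> {..<p}. c j * av j \<alpha>)"
    have Wx: "(\<Sum>j\<in>X \<times> {..<p}. c j * bv j \<beta>) = (\<Sum>\<alpha>\<in>A. W \<beta> \<alpha> * x \<alpha>)" if "\<beta> \<in> B" for \<beta>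
    proof -
      have "(\<Sum>j\<in>X \<times> {..<p}. c j * bv j \<beta>) = (\<Sum>j\<in>X \<times> {..<p}. \<Sum>\<alpha>\<in>A. W \<beta> \<alpha> * (c j * av j \<alpha>))"
        by (intro sum.cong refl) (simp add: sum_distrib_left mult_ac that flip: W_av)
      also have "\<dots> = (\<Sum>\<alpha>\<in>A. W \<beta> \<alpha> * x \<alpha>)"
        by (subst sum.swap) (simp add: x_def sum_distrib_left)
      finally show ?thesis .
    qed
    have "sesq (X \<times> {..<p}) P c c
        = sesq (X \<times> {..<p}) (\<lambda>i j. \<Sum>\<alpha>\<in>A. av i \<alpha> * cnj (av j \<alpha>)) c c
        - sesq (X \<times> {..<p}) (\<lambda>i j. \<Sum>\<beta>\<in>B. bv i \<beta> * cnj (bv j \<beta>)) c c"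
      by (simp add: sesq_def P_def right_diff_distrib sum_subtractf)
    also have "\<dots> = (\<Sum>\<alpha>\<in>A. x \<alpha> * cnj (x \<alpha>))
        - (\<Sum>\<beta>\<in>B. (\<Sum>\<alpha>\<in>A. W \<beta> \<alpha> * x \<alpha>) * cnj (\<Sum>\<alpha>\<in>A. W \<beta> \<alpha> * x \<alpha>))"
    proof -
      have "(\<Sum>j\<in>X \<times> {..<p}. c j * av j \<alpha>) = x \<alpha>" for \<alpha> by (simp add: x_def)
      then show ?thesis unfolding sesq_gram by (simp add: Wx del: cnj_sum)
    qed
    finally have "Re (sesq (X \<times> {..<p}) P c c)
        = (\<Sum>\<alpha>\<in>A. (cmod (x \<alpha>))\<^sup>2) - (\<Sum>\<beta>\<in>B. (cmod (\<Sum>\<alpha>\<in>A. W \<beta> \<alpha> * x \<alpha>))\<^sup>2)"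
      by (simp only: minus_complex.sel Re_sum Re_mult_cnj_self)
    then show "0 \<le> Re (sesq (X \<times> {..<p}) P c c)" using W_contr[of x] by simp
  qed
  \<comment> \<open>The computation on Y run backwards: k (1 - g) = 1 absorbs the states. What
    remains is a Gram kernel plus a Schur product of positive kernels.\<close>
  have "pick_kernel k 1 q m' i j = (\<Sum>h<r. u i h * cnj (u j h)) + k (fst i) (fst j) * P i j"
    if ij: "i \<in> X \<times> {..<p}" "j \<in> X \<times> {..<p}" for i j
  proof -
    define g where "g = (\<Sum>v\<in>V. \<phi> (fst i) v * cnj (\<phi> (fst j) v))"
    define M where "M = (\<Sum>l<q. m' (fst i) (snd i) l * cnj (m' (fst j) (snd j) l))"
    define U where "U = (\<Sum>h<r. u i h * cnj (u j h))"
    have ij': "fst i \<in> X" "fst j \<in> X" "snd i < p" using ij by auto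
    have P: "P i j = of_bool (snd i = snd j) + g * U - (M + U)"
      unfolding P_def av_def bv_def A_def row_tensor_gram[OF V ij'(3)] B_gram
      by (simp add: g_def M_def U_def)
    have "U + \<kappa> * (b + g * U - (M + U)) = U - (\<kappa> * (1 - g)) * U + \<kappa> * (b - M)" for \<kappa> b
      by (simp add: algebra_simps)
    then have "U + k (fst i) (fst j) * P i j
        = U - (k (fst i) (fst j) * (1 - g)) * U + k (fst i) (fst j) * (of_bool (snd i = snd j) - M)"
      unfolding P .
    also have "k (fst i) (fst j) * (1 - g) = 1" using k[OF ij'(1,2)] by (simp add: g_def)
    finally show ?thesis by (simp add: pick_kernel_def M_def U_def)
  qed
  then have "psd_on (X \<times> {..<p}) (pick_kernel k 1 q m') \<longleftrightarrow>
      psd_on (X \<times> {..<p}) (\<lambda>i j. (\<Sum>h<r. u i h * cnj (u j h)) + k (fst i) (fst j) * P i j)"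
    by (rule psd_on_cong)
  moreover have "psd_on (X \<times> {..<p}) (\<lambda>i j. k (fst i) (fst j))"
    using psd_on_reindex[OF k_psd X, of "X \<times> {..<p}" fst] X by auto
  ultimately have "psd_on (X \<times> {..<p}) (pick_kernel k 1 q m')"
    using P_psd X by (simp add: psd_on_add psd_on_gram psd_on_schur_product)
  moreover have "m' y i l = m y i l" if "y \<in> Y" "i < p" "l < q" for y i l
    using W[of "(y, i)" "Inl l"] uY[of "(y, i)"] that by (simp add: m'_def av_def J_def B_def InlI)
  ultimately show ?thesis using that by blast
qed

section \<open>Spaces spanned by kernel functions\<close>

definition kcomb :: "('x \<Rightarrow> 'x \<Rightarrow> complex) \<Rightarrow> 'x set \<Rightarrow> ('x \<Rightarrow> complex) \<Rightarrow> 'x \<Rightarrow> complex" where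
  "kcomb K Y c = (\<lambda>z. \<Sum>x\<in>Y. c x * K x z)"

lemma kcomb_insert:
  "finite F \<Longrightarrow> x \<notin> F \<Longrightarrow> kcomb K (insert x F) c = (\<lambda>z. c x * K x z) + kcomb K F c"
  by (auto simp: kcomb_def)

lemma span_eq_range_kcomb:
  assumes "finite Y"
  shows "cfun.span (K ` Y) = range (kcomb K Y)"
proof
  show "range (kcomb K Y) \<subseteq> cfun.span (K ` Y)"
  proof clarify
    fix c
    show "kcomb K Y c \<in> cfun.span (K ` Y)"
      using assms
    proof (induction rule: finite_induct)
      case empty
      have "kcomb K {} c = 0" by (auto simp: kcomb_def)
      then show ?case by (simp only: cfun.span_zero)
    next
      case (insert x F)
      have "kcomb K F c \<in> cfun.span (K ` insert x F)"
        using insert.IH cfun.span_mono[of "K ` F" "K ` insert x F"] by auto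
      moreover have "(\<lambda>z. c x * K x z) \<in> cfun.span (K ` insert x F)"
        by (intro cfun.span_scale cfun.span_base) simp
      ultimately show ?case
        unfolding kcomb_insert[OF insert.hyps] by (rule cfun.span_add[rotated])
    qed
  qed
  have "cfun.subspace (range (kcomb K Y))"
    unfolding cfun.subspace_def
  proof (intro conjI ballI allI)
    have "kcomb K Y (\<lambda>_. 0) = 0" by (auto simp: kcomb_def)
    then show "0 \<in> range (kcomb K Y)" by (metis rangeI)
    fix f g assume "f \<in> range (kcomb K Y)" "g \<in> range (kcomb K Y)"
    then obtain c d where "f = kcomb K Y c" "g = kcomb K Y d" by blast
    then have "f + g = kcomb K Y (\<lambda>x. c x + d x)"
      by (auto simp: kcomb_def sum.distrib algebra_simps)
    then show "f + g \<in> range (kcomb K Y)" by blast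
  next
    fix a f assume "f \<in> range (kcomb K Y)"
    then obtain c where "f = kcomb K Y c" by blast
    then have "(\<lambda>x. a * f x) = kcomb K Y (\<lambda>x. a * c x)"
      by (auto simp: kcomb_def sum_distrib_left algebra_simps)
    then show "(\<lambda>x. a * f x) \<in> range (kcomb K Y)" by blast
  qed
  moreover have "K x \<in> range (kcomb K Y)" if "x \<in> Y" for x
  proof -
    have "K x = kcomb K Y (point x)"
      using assms that by (auto simp: kcomb_def sum_point)
    then show ?thesis by blast
  qed
  ultimately show "cfun.span (K ` Y) \<subseteq> range (kcomb K Y)"
    by (intro cfun.span_minimal) auto
qed

lemma
  assumes "inner_product_space H"
  shows ips_subspace: "cfun.subspace (funs H)"
    and ips_vanish: "f \<in> funs H \<Longrightarrow> x \<notin> pts H \<Longrightarrow> f x = 0"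
    and ips_add: "f \<in> funs H \<Longrightarrow> g \<in> funs H \<Longrightarrow> h \<in> funs H \<Longrightarrow> ip H (f + g) h = ip H f h + ip H g h"
    and ips_scale: "f \<in> funs H \<Longrightarrow> g \<in> funs H \<Longrightarrow> ip H (\<lambda>x. c * f x) g = c * ip H f g"
    and ips_cnj: "f \<in> funs H \<Longrightarrow> g \<in> funs H \<Longrightarrow> ip H g f = cnj (ip H f g)"
    and ips_nonneg: "f \<in> funs H \<Longrightarrow> 0 \<le> Re (ip H f f)"
    and ips_definite: "f \<in> funs H \<Longrightarrow> ip H f f = 0 \<Longrightarrow> f = 0"
  using assms unfolding inner_product_space_def by blast+

lemma
  assumes "rkhs H"
  shows rkhs_ips: "inner_product_space H"
    and rkhs_ker: "x \<in> pts H \<Longrightarrow> ker H x \<in> funs H"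
    and rkhs_eval: "x \<in> pts H \<Longrightarrow> f \<in> funs H \<Longrightarrow> ip H f (ker H x) = f x"
  using assms unfolding rkhs_def by auto

lemma ips_zero_right:
  assumes "inner_product_space H" "f \<in> funs H"
  shows "ip H f 0 = 0"
proof -
  have "0 \<in> funs H" using ips_subspace[OF assms(1)] by (rule cfun.subspace_0)
  moreover have "(\<lambda>x. 0 * (0 :: 'a \<Rightarrow> complex) x) = 0" by auto
  ultimately have "ip H 0 f = 0" using ips_scale[OF assms(1), of 0 f 0] assms(2) by simp
  with \<open>0 \<in> funs H\<close> show ?thesis using ips_cnj[OF assms(1), of 0 f] assms(2) by simp
qed

text \<open>The reproducing property extended conjugate-linearly: pairing with a combination of
  kernel functions only samples f at the points, which reduces inner products to finite sums of
  values.\<close>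

lemma rkhs_kcomb:
  assumes H: "rkhs H" and Y: "finite Y" "Y \<subseteq> pts H"
  shows "kcomb (ker H) Y c \<in> funs H"
    and "f \<in> funs H \<Longrightarrow> ip H f (kcomb (ker H) Y c) = (\<Sum>y\<in>Y. f y * cnj (c y))"
proof -
  note ips = rkhs_ips[OF H]
  have "kcomb (ker H) Y c \<in> funs H \<and>
      (\<forall>f\<in>funs H. ip H f (kcomb (ker H) Y c) = (\<Sum>y\<in>Y. f y * cnj (c y)))"
    using Y
  proof (induction rule: finite_induct)
    case empty
    have "kcomb (ker H) {} c = 0" by (auto simp: kcomb_def)
    moreover have "0 \<in> funs H" by (rule cfun.subspace_0[OF ips_subspace[OF ips]])
    ultimately show ?case using ips_zero_right[OF ips] by (metis sum.empty)
  next
    case (insert x F)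
    let ?s = "\<lambda>z. c x * ker H x z"
    have x: "ker H x \<in> funs H" using insert.prems H by (simp add: rkhs_ker)
    then have s: "?s \<in> funs H" by (intro cfun.subspace_scale[OF ips_subspace[OF ips]])
    have F: "kcomb (ker H) F c \<in> funs H" using insert by auto
    have sF: "?s + kcomb (ker H) F c \<in> funs H"
      by (intro cfun.subspace_add[OF ips_subspace[OF ips]] s F)
    have "ip H f (?s + kcomb (ker H) F c) = f x * cnj (c x) + (\<Sum>y\<in>F. f y * cnj (c y))"
      if f: "f \<in> funs H" for f
    proof -
      have "ip H f (?s + kcomb (ker H) F c) = cnj (ip H ?s f + ip H (kcomb (ker H) F c) f)"
        by (simp only: ips_cnj[OF ips sF f] ips_add[OF ips s F f])
      also have "\<dots> = cnj (c x * ip H (ker H x) f) + ip H f (kcomb (ker H) F c)"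
        using ips_scale[OF ips x f, of "c x"] ips_cnj[OF ips F f] by simp
      also have "ip H (ker H x) f = cnj (f x)"
        using rkhs_eval[OF H _ f] insert.prems ips_cnj[OF ips f x] by simp
      also have "ip H f (kcomb (ker H) F c) = (\<Sum>y\<in>F. f y * cnj (c y))"
        using insert f by blast
      finally show ?thesis by (simp only: complex_cnj_mult complex_cnj_cnj mult.commute)
    qed
    with sF show ?case unfolding kcomb_insert[OF insert.hyps] sum.insert[OF insert.hyps] by blast
  qed
  then show "kcomb (ker H) Y c \<in> funs H"
    and "f \<in> funs H \<Longrightarrow> ip H f (kcomb (ker H) Y c) = (\<Sum>y\<in>Y. f y * cnj (c y))" by blast+
qed

lemma rkhs_ker_cnj:
  assumes "rkhs H" "x \<in> pts H" "y \<in> pts H"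
  shows "ker H y x = cnj (ker H x y)"
  using ips_cnj[OF rkhs_ips[OF assms(1)], of "ker H x" "ker H y"] assms
  by (simp add: rkhs_ker rkhs_eval)

lemma rkhs_ip_kcomb_kcomb:
  assumes H: "rkhs H" and Y: "finite Y" "Y \<subseteq> pts H"
  shows "ip H (kcomb (ker H) Y c) (kcomb (ker H) Y d) = sesq Y (ker H) c d"
proof -
  have "ip H (kcomb (ker H) Y c) (kcomb (ker H) Y d)
      = (\<Sum>y\<in>Y. \<Sum>x\<in>Y. c x * cnj (d y) * ker H x y)"
    using rkhs_kcomb(2)[OF assms rkhs_kcomb(1)[OF assms]]
    by (simp add: kcomb_def sum_distrib_left mult_ac)
  also have "\<dots> = sesq Y (ker H) c d" unfolding sesq_def by (rule sum.swap)
  finally show ?thesis .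
qed

lemma rkhs_psd:
  assumes "rkhs H" "finite Y" "Y \<subseteq> pts H"
  shows "psd_on Y (ker H)"
  unfolding psd_on_def
proof (intro conjI ballI allI)
  show "ker H y x = cnj (ker H x y)" if "x \<in> Y" "y \<in> Y" for x y
    using rkhs_ker_cnj[OF assms(1), of x y] that assms(3) by blast
  show "0 \<le> Re (sesq Y (ker H) c c)" for c
    using ips_nonneg[OF rkhs_ips[OF assms(1)] rkhs_kcomb(1)[OF assms]]
    by (simp add: rkhs_ip_kcomb_kcomb[OF assms])
qed

text \<open>The common setting for \<open>H\<close>, its subspaces and the span of finitely many
  kernel functions of the Drury-Arveson space. Spanning provides coefficient functions, possibly
  several for one element.\<close>

definition spanned_rkhs :: "'x function_space \<Rightarrow> bool" where
  "spanned_rkhs H \<longleftrightarrow> rkhs H \<and> finite (pts H) \<and> funs H = cfun.span (ker H ` pts H)"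

lemma spanned_rkhs_funs: "spanned_rkhs H \<Longrightarrow> funs H = range (kcomb (ker H) (pts H))"
  by (simp add: spanned_rkhs_def span_eq_range_kcomb)

lemma finite_rkhs_spanned: "finite_rkhs H \<Longrightarrow> spanned_rkhs H"
  by (simp add: finite_rkhs_def spanned_rkhs_def)

lemma rkhs_sub_simps [simp]:
  "pts (rkhs_sub H Y) = Y" "ker (rkhs_sub H Y) = (\<lambda>y. restrict0 Y (ker H y))"
  by (simp_all add: rkhs_sub_def Let_def)

lemma spanned_rkhs_sub:
  assumes H: "rkhs H" and Y: "finite Y" "Y \<subseteq> pts H"
  shows "spanned_rkhs (rkhs_sub H Y)"
proof -
  note ips = rkhs_ips[OF H]
  define S where "S = range (kcomb (ker H) Y)"
  define lift where "lift = the_inv_into S (restrict0 Y)"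
  have S_funs: "f \<in> funs H" if "f \<in> S" for f
    using that rkhs_kcomb(1)[OF assms] by (auto simp: S_def)
  have S_span: "S = cfun.span (ker H ` Y)" by (simp add: S_def span_eq_range_kcomb Y(1))
  have S_sub: "cfun.subspace S" unfolding S_span by (rule cfun.subspace_span)
  have "inj_on (restrict0 Y) S"
  proof (rule inj_onI)
    fix f g assume fg: "f \<in> S" "g \<in> S" "restrict0 Y f = restrict0 Y g"
    have "f - g \<in> S" using fg(1,2) S_sub by (rule cfun.subspace_diff[rotated])
    then obtain c where c: "f - g = kcomb (ker H) Y c" by (auto simp: S_def)
    have "f y = g y" if "y \<in> Y" for y using fun_cong[OF fg(3), of y] that by (simp add: restrict0_def)
    \<comment> \<open>Pairing f - g with its own expansion only involves its values on Y.\<close>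
    then have "ip H (f - g) (f - g) = 0"
      using rkhs_kcomb(2)[OF assms S_funs[OF \<open>f - g \<in> S\<close>], of c] by (simp flip: c)
    with ips_definite[OF ips S_funs[OF \<open>f - g \<in> S\<close>]] show "f = g" by simp
  qed
  then have lift: "lift (restrict0 Y f) = f" if "f \<in> S" for f
    using that unfolding lift_def by (rule the_inv_into_f_f)
  have funs: "funs (rkhs_sub H Y) = restrict0 Y ` S"
    by (simp add: rkhs_sub_def Let_def S_span)
  have ip: "ip (rkhs_sub H Y) (restrict0 Y f) (restrict0 Y g) = ip H f g" if "f \<in> S" "g \<in> S" for f g
    using lift[OF that(1)] lift[OF that(2)] by (simp add: rkhs_sub_def Let_def lift_def S_span)
  have add: "restrict0 Y f + restrict0 Y g = restrict0 Y (f + g)" for f g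
    by (auto simp: restrict0_def)
  have scale: "(\<lambda>x. c * restrict0 Y f x) = restrict0 Y (\<lambda>x. c * f x)" for c f
    by (auto simp: restrict0_def)
  have zero: "restrict0 Y 0 = 0" by (auto simp: restrict0_def)
  have S_add: "f + g \<in> S" and S_scale: "(\<lambda>x. c * f x) \<in> S" if "f \<in> S" "g \<in> S" for f g c
    using that S_sub cfun.subspace_add cfun.subspace_scale by blast+
  have "inner_product_space (rkhs_sub H Y)"
    unfolding inner_product_space_def funs
  proof (intro conjI ballI allI impI)
    show "cfun.subspace (restrict0 Y ` S)"
      unfolding cfun.subspace_def using cfun.subspace_0[OF S_sub] S_add S_scale
      by (auto simp: add scale) (metis zero image_eqI)
    show "f x = 0" if "f \<in> restrict0 Y ` S" "x \<notin> pts (rkhs_sub H Y)" for f x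
      using that by (auto simp: restrict0_def)
    show "ip (rkhs_sub H Y) (f + g) h = ip (rkhs_sub H Y) f h + ip (rkhs_sub H Y) g h"
      if "f \<in> restrict0 Y ` S" "g \<in> restrict0 Y ` S" "h \<in> restrict0 Y ` S" for f g h
      using that by (auto simp: add ip S_add S_funs ips_add[OF ips])
    show "ip (rkhs_sub H Y) (\<lambda>x. c * f x) g = c * ip (rkhs_sub H Y) f g"
      if "f \<in> restrict0 Y ` S" "g \<in> restrict0 Y ` S" for c f g
      using that by (auto simp: scale ip S_scale S_funs ips_scale[OF ips])
    show "ip (rkhs_sub H Y) g f = cnj (ip (rkhs_sub H Y) f g)"
      if "f \<in> restrict0 Y ` S" "g \<in> restrict0 Y ` S" for f g
      using that by (auto simp: ip intro!: ips_cnj[OF ips] S_funs)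
    show "0 \<le> Re (ip (rkhs_sub H Y) f f)" if "f \<in> restrict0 Y ` S" for f
      using that by (auto simp: ip intro!: ips_nonneg[OF ips] S_funs)
    show "f = 0" if f: "f \<in> restrict0 Y ` S" "ip (rkhs_sub H Y) f f = 0" for f
    proof -
      obtain g where g: "g \<in> S" "f = restrict0 Y g" using f(1) by blast
      with f(2) have "g = 0" using ips_definite[OF ips S_funs] by (simp add: ip)
      with g zero show ?thesis by simp
    qed
  qed
  moreover have ker_S: "ker H y \<in> S" if "y \<in> Y" for y
    unfolding S_span using that by (intro cfun.span_base) simp
  moreover have "f y = ip (rkhs_sub H Y) f (restrict0 Y (ker H y))"
    if "y \<in> Y" "f \<in> restrict0 Y ` S" for f y
  proof -
    obtain g where g: "g \<in> S" "f = restrict0 Y g" using \<open>f \<in> restrict0 Y ` S\<close> by blast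
    have "ip (rkhs_sub H Y) f (restrict0 Y (ker H y)) = g y"
      unfolding g(2) ip[OF g(1) ker_S[OF that(1)]]
      using rkhs_eval[OF H _ S_funs[OF g(1)]] that(1) Y(2) by blast
    then show ?thesis using that(1) by (simp add: g(2) restrict0_def)
  qed
  ultimately have "rkhs (rkhs_sub H Y)" by (auto simp: rkhs_def funs)
  moreover have "restrict0 Y ` S = cfun.span ((\<lambda>y. restrict0 Y (ker H y)) ` Y)"
  proof -
    have "restrict0 Y (kcomb (ker H) Y c) = kcomb (\<lambda>y. restrict0 Y (ker H y)) Y c" for c
      by (auto simp: restrict0_def kcomb_def)
    then show ?thesis by (simp add: S_def image_image span_eq_range_kcomb[OF Y(1)])
  qed
  ultimately show ?thesis using Y(1) by (simp add: spanned_rkhs_def funs)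
qed

text \<open>A kernel determines the space it spans: elements are given by coefficients, and inner
  products by values against coefficients, so a bijection of the points that matches the kernel
  functions matches everything.\<close>

lemma same_rkhs_viaI:
  assumes H: "spanned_rkhs H" and G: "spanned_rkhs G" and bij: "bij_betw \<Phi> (pts H) (pts G)"
    and ker: "\<And>x. x \<in> pts H \<Longrightarrow> ker H x = pullback \<Phi> (pts H) (ker G (\<Phi> x))"
  shows "same_rkhs_via \<Phi> H G"
proof -
  have rH: "rkhs H" "finite (pts H)" and rG: "rkhs G" "finite (pts G)"
    using H G by (auto simp: spanned_rkhs_def)
  have pb: "pullback \<Phi> (pts H) (kcomb (ker G) (pts G) c) = kcomb (ker H) (pts H) (c \<circ> \<Phi>)" for c
  proof
    fix z
    have "(\<Sum>y\<in>pts G. c y * ker G y w) = (\<Sum>x\<in>pts H. c (\<Phi> x) * ker G (\<Phi> x) w)" for w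
      by (rule sum.reindex_bij_betw[OF bij, symmetric])
    then show "pullback \<Phi> (pts H) (kcomb (ker G) (pts G) c) z = kcomb (ker H) (pts H) (c \<circ> \<Phi>) z"
      by (simp add: kcomb_def ker) (simp add: pullback_def)
  qed
  have "funs H = pullback \<Phi> (pts H) ` funs G"
  proof
    show "pullback \<Phi> (pts H) ` funs G \<subseteq> funs H"
      by (auto simp: spanned_rkhs_funs[OF G] spanned_rkhs_funs[OF H] pb)
    show "funs H \<subseteq> pullback \<Phi> (pts H) ` funs G"
    proof
      fix f assume "f \<in> funs H"
      then obtain d where d: "f = kcomb (ker H) (pts H) d" by (auto simp: spanned_rkhs_funs[OF H])
      have "kcomb (ker H) (pts H) d = kcomb (ker H) (pts H) ((d \<circ> the_inv_into (pts H) \<Phi>) \<circ> \<Phi>)"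
        unfolding kcomb_def using bij
        by (intro ext sum.cong) (auto simp: the_inv_into_f_f bij_betw_def)
      then show "f \<in> pullback \<Phi> (pts H) ` funs G"
        unfolding spanned_rkhs_funs[OF G] image_image pb d by blast
    qed
  qed
  moreover have "ip H (pullback \<Phi> (pts H) f) (pullback \<Phi> (pts H) g) = ip G f g"
    if f: "f \<in> funs G" and "g \<in> funs G" for f g
  proof -
    obtain d where d: "g = kcomb (ker G) (pts G) d" using \<open>g \<in> funs G\<close> by (auto simp: spanned_rkhs_funs[OF G])
    have "pullback \<Phi> (pts H) f \<in> funs H" using f calculation by blast
    then have "ip H (pullback \<Phi> (pts H) f) (pullback \<Phi> (pts H) g) = (\<Sum>x\<in>pts H. f (\<Phi> x) * cnj (d (\<Phi> x)))"
      unfolding d pb using rkhs_kcomb(2)[OF rH order_refl] by (simp add: pullback_def)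
    also have "\<dots> = (\<Sum>y\<in>pts G. f y * cnj (d y))" by (rule sum.reindex_bij_betw[OF bij])
    also have "\<dots> = ip G f g" unfolding d using rkhs_kcomb(2)[OF rG order_refl f] by simp
    finally show ?thesis .
  qed
  ultimately show ?thesis using bij ker by (simp add: same_rkhs_via_def)
qed

lemma sum_fun_apply: "(\<Sum>i\<in>I. f i) x = (\<Sum>i\<in>I. f i x)"
  by (induction I rule: infinite_finite_induct) auto

text \<open>Moore's construction. The inner product pairs the values of f with chosen coefficients
  of g, so linearity in f is immediate; symmetry and positivity come from its equality with the form
  \<open>sesq\<close>. Definiteness of that form gives independence of the kernel functions.\<close>

lemma finite_rkhs_exists:
  assumes X: "finite X" and psd: "psd_on X k"
    and definite: "\<And>c x. sesq X k c c = 0 \<Longrightarrow> x \<in> X \<Longrightarrow> c x = 0"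
  obtains H where "finite_rkhs H" "pts H = X" "has_kernel H k" "\<And>x. ker H x = restrict0 X (k x)"
proof -
  define K where "K = (\<lambda>x. restrict0 X (k x))"
  define F where "F = range (kcomb K X)"
  define coef where "coef = (\<lambda>g. SOME d. g = kcomb K X d)"
  define H where "H = \<lparr>pts = X, funs = F, ip = (\<lambda>f g. \<Sum>y\<in>X. f y * cnj (coef g y)), ker = K\<rparr>"
  have k_cnj: "k y x = cnj (k x y)" if "x \<in> X" "y \<in> X" for x y
    using psd that unfolding psd_on_def by blast
  have F_span: "F = cfun.span (K ` X)" by (simp add: F_def span_eq_range_kcomb X)
  have coef: "kcomb K X (coef g) = g" if "g \<in> F" for g
    using that unfolding F_def coef_def by (metis (mono_tags, lifting) image_iff someI)
  have kcomb_at: "kcomb K X c y = (\<Sum>x\<in>X. c x * k x y)" if "y \<in> X" for c y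
    using that by (simp add: kcomb_def K_def restrict0_def)
  have sesq_kcomb: "(\<Sum>y\<in>X. kcomb K X c y * cnj (d y)) = sesq X k c d" for c d
  proof -
    have "(\<Sum>y\<in>X. kcomb K X c y * cnj (d y)) = (\<Sum>y\<in>X. \<Sum>x\<in>X. c x * cnj (d y) * k x y)"
      by (simp add: kcomb_at sum_distrib_left mult_ac)
    also have "\<dots> = sesq X k c d" unfolding sesq_def by (rule sum.swap)
    finally show ?thesis .
  qed
  have ip: "ip H f g = sesq X k (coef f) (coef g)" if "f \<in> F" for f g
    using sesq_kcomb[of "coef f" "coef g"] by (simp add: H_def coef that)
  have unique: "c x = 0" if "kcomb K X c = 0" "x \<in> X" for c x
    using definite[of c x] sesq_kcomb[of c c] that by simp
  have vanish: "f x = 0" if "f \<in> F" "x \<notin> X" for f x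
    using that by (auto simp: F_def kcomb_def K_def restrict0_def)
  have ips: "inner_product_space H"
    unfolding inner_product_space_def
  proof (intro conjI ballI allI impI)
    show "cfun.subspace (funs H)" by (simp add: H_def F_span)
    show "f x = 0" if "f \<in> funs H" "x \<notin> pts H" for f x using that vanish by (simp add: H_def)
    show "ip H (f + g) h = ip H f h + ip H g h" for f g h
      by (simp add: H_def sum.distrib algebra_simps)
    show "ip H (\<lambda>x. c * f x) g = c * ip H f g" for c f g
      by (simp add: H_def sum_distrib_left mult_ac)
    show "ip H g f = cnj (ip H f g)" if "f \<in> funs H" "g \<in> funs H" for f g
    proof -
      have fg: "f \<in> F" "g \<in> F" using that by (simp_all add: H_def)
      show ?thesis unfolding ip[OF fg(1)] ip[OF fg(2)] by (rule sesq_hermitian[OF psd])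
    qed
    show "0 \<le> Re (ip H f f)" if "f \<in> funs H" for f
      using that ip[of f f] sesq_self(2)[OF psd] by (simp add: H_def)
    show "f = 0" if "f \<in> funs H" "ip H f f = 0" for f
    proof -
      have f: "f \<in> F" using that by (simp add: H_def)
      with that(2) have "sesq X k (coef f) (coef f) = 0" using ip[OF f, of f] by simp
      then have "coef f x = 0" if "x \<in> X" for x using definite that by blast
      then have "kcomb K X (coef f) = 0" by (auto simp: kcomb_def)
      with coef[OF f] show ?thesis by simp
    qed
  qed
  have K_F: "K x \<in> F" if "x \<in> X" for x
    unfolding F_span using that by (intro cfun.span_base) simp
  have eval: "f x = ip H f (K x)" if "x \<in> X" "f \<in> F" for f x
  proof -
    \<comment> \<open>The arguments are swapped so that the coefficients of f enter instead of the
      chosen coefficients of K x.\<close>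
    have "ip H f (K x) = cnj (ip H (K x) f)"
      using ips_cnj[OF ips, of "K x" f] K_F that by (simp add: H_def)
    also have "\<dots> = (\<Sum>y\<in>X. coef f y * k y x)"
    proof -
      have "ip H (K x) f = (\<Sum>y\<in>X. cnj (coef f y * k y x))"
        unfolding H_def using that(1)
        by (auto simp: K_def restrict0_def k_cnj[of x] intro!: sum.cong)
      then show ?thesis by simp
    qed
    also have "\<dots> = f x" using kcomb_at[OF that(1), of "coef f"] coef[OF that(2)] by simp
    finally show ?thesis by simp
  qed
  have inj: "inj_on K X"
  proof (rule inj_onI, rule ccontr)
    fix x y assume xy: "x \<in> X" "y \<in> X" "K x = K y" "x \<noteq> y"
    have "kcomb K X (\<lambda>z. point x z - point y z) = 0"
      using xy X by (auto simp: kcomb_def left_diff_distrib sum_subtractf sum_point)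
    from unique[OF this xy(1)] show False using xy(4) by (simp add: point_def)
  qed
  have "cfun.independent (K ` X)"
  proof (rule cfun.independent_if_scalars_zero)
    fix f v assume f: "(\<Sum>v\<in>K ` X. (\<lambda>x. f v * v x)) = 0" and "v \<in> K ` X"
    then obtain x where x: "x \<in> X" "v = K x" by blast
    have "kcomb K X (f \<circ> K) = (\<Sum>v\<in>K ` X. (\<lambda>x. f v * v x))"
      by (auto simp: kcomb_def sum_fun_apply sum.reindex[OF inj])
    from unique[OF this[unfolded f] x(1)] x(2) show "f v = 0" by simp
  qed (simp add: X)
  moreover have "rkhs H" using ips K_F eval by (auto simp: rkhs_def H_def)
  ultimately have "finite_rkhs H" using X inj by (simp add: finite_rkhs_def H_def F_span)
  moreover have "has_kernel H k"
    unfolding has_kernel_def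
  proof (intro ballI)
    fix x y assume "x \<in> pts H" "y \<in> pts H"
    then have xy: "x \<in> X" "y \<in> X" by (simp_all add: H_def)
    have "ip H (ker H x) (ker H y) = K x y"
      using eval[OF xy(2) K_F[OF xy(1)]] by (simp add: H_def)
    with xy show "ip H (ker H x) (ker H y) = k x y" by (simp add: K_def restrict0_def)
  qed
  ultimately show ?thesis by (intro that[of H]) (simp_all add: H_def K_def)
qed

text \<open>A dimension count: the kernel functions are as many independent vectors as there are
  points, so a function outside their span would exceed the dimension of the functions supported on
  \<open>pts H\<close>. As a consequence, multiplication by any matrix function stays within tuples
  of elements of H.\<close>

lemma finite_rkhs_funs:
  assumes H: "finite_rkhs H" and f: "\<And>x. x \<notin> pts H \<Longrightarrow> f x = 0"
  shows "f \<in> funs H"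
proof (rule ccontr)
  assume "f \<notin> funs H"
  let ?X = "pts H"
  have X: "finite ?X" and inj: "inj_on (ker H) ?X" and ind: "cfun.independent (ker H ` ?X)"
    and funs: "funs H = cfun.span (ker H ` ?X)" and ips: "inner_product_space H" and r: "rkhs H"
    using H by (auto simp: finite_rkhs_def rkhs_def)
  have points: "g \<in> cfun.span (point ` ?X)" if "\<And>x. x \<notin> ?X \<Longrightarrow> g x = 0" for g
  proof -
    have "g z = kcomb point ?X g z" for z
    proof (cases "z \<in> ?X")
      case True
      then show ?thesis using sum_point[OF X True, of g]
        by (simp add: kcomb_def point_def mult.commute eq_commute cong: sum.cong)
    next
      case False
      then have "point x z = 0" if "x \<in> ?X" for x using that by (auto simp: point_def)
      with False that show ?thesis by (simp add: kcomb_def)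
    qed
    then have "g = kcomb point ?X g" by blast
    then show ?thesis unfolding span_eq_range_kcomb[OF X] by blast
  qed
  have "f \<notin> ker H ` ?X" using \<open>f \<notin> funs H\<close> rkhs_ker[OF r] by blast
  then have "card (insert f (ker H ` ?X)) = Suc (card ?X)" using X inj by (simp add: card_image)
  moreover have "cfun.independent (insert f (ker H ` ?X))"
    using ind \<open>f \<notin> funs H\<close> unfolding funs by (rule cfun.independent_insertI[rotated])
  moreover have "insert f (ker H ` ?X) \<subseteq> cfun.span (point ` ?X)"
  proof -
    have "ker H x \<in> cfun.span (point ` ?X)" if "x \<in> ?X" for x
      using ips_vanish[OF ips rkhs_ker[OF r that]] by (intro points)
    moreover have "f \<in> cfun.span (point ` ?X)" using f by (intro points)
    ultimately show ?thesis by blast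
  qed
  ultimately have "Suc (card ?X) \<le> card (point ` ?X)"
    using cfun.independent_span_bound[of "point ` ?X" "insert f (ker H ` ?X)"] X by simp
  with card_image_le[OF X, of point] show False by simp
qed

section \<open>Multipliers and Pick kernels\<close>

text \<open>The Gram kernel of the vectors k_x tensored with e_i, which span the tensor product of H
  with \<complex>^q.\<close>

definition tuple_kernel :: "('x \<Rightarrow> 'x \<Rightarrow> complex) \<Rightarrow> 'x \<times> nat \<Rightarrow> 'x \<times> nat \<Rightarrow> complex" where
  "tuple_kernel k i j = k (fst i) (fst j) * of_bool (snd i = snd j)"

lemma sesq_tuple_kernel:
  "sesq (X \<times> {..<q}) (tuple_kernel k) c d = (\<Sum>l<q. sesq X k (\<lambda>x. c (x, l)) (\<lambda>x. d (x, l)))"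
proof -
  have "sesq (X \<times> {..<q}) (tuple_kernel k) c d
      = (\<Sum>x\<in>X. \<Sum>l<q. \<Sum>y\<in>X. \<Sum>l'<q. c (x, l) * cnj (d (y, l')) * tuple_kernel k (x, l) (y, l'))"
    unfolding sesq_def sum.cartesian_product' ..
  also have "\<dots> = (\<Sum>x\<in>X. \<Sum>l<q. \<Sum>y\<in>X. c (x, l) * cnj (d (y, l)) * k x y)"
  proof (intro sum.cong refl)
    fix x l y assume "l \<in> {..<q}"
    then have "(\<Sum>l'<q. if l' = l then c (x, l) * cnj (d (y, l)) * k x y else 0)
        = c (x, l) * cnj (d (y, l)) * k x y" by simp
    then show "(\<Sum>l'<q. c (x, l) * cnj (d (y, l')) * tuple_kernel k (x, l) (y, l'))
        = c (x, l) * cnj (d (y, l)) * k x y"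
      by (subst (asm) sum.cong[OF refl,
            where h = "\<lambda>l'. c (x, l) * cnj (d (y, l')) * tuple_kernel k (x, l) (y, l')"])
        (auto simp: tuple_kernel_def)
  qed
  also have "\<dots> = (\<Sum>l<q. sesq X k (\<lambda>x. c (x, l)) (\<lambda>x. d (x, l)))"
    unfolding sesq_def by (rule sum.swap)
  finally show ?thesis .
qed

lemma psd_on_tuple_kernel:
  assumes "psd_on X k"
  shows "psd_on (X \<times> {..<q}) (tuple_kernel k)"
proof -
  have "tuple_kernel k j i = cnj (tuple_kernel k i j)"
    if "i \<in> X \<times> {..<q}" "j \<in> X \<times> {..<q}" for i j
  proof -
    have "k (fst j) (fst i) = cnj (k (fst i) (fst j))"
      using assms that unfolding psd_on_def by (metis mem_Times_iff)
    then show ?thesis by (simp add: tuple_kernel_def)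
  qed
  moreover have "0 \<le> (\<Sum>l<q. Re (sesq X k (\<lambda>x. c (x, l)) (\<lambda>x. c (x, l))))" for c
    by (intro sum_nonneg sesq_self(2)[OF assms])
  ultimately show ?thesis unfolding psd_on_def sesq_tuple_kernel Re_sum by blast
qed

text \<open>The adjoint of multiplication by \<open>M\<close> on kernel functions, in coefficients, where
  \<open>m\<close> is the entrywise conjugate of \<open>M\<close>.\<close>

definition adj_coef :: "nat \<Rightarrow> ('x \<Rightarrow> nat \<Rightarrow> nat \<Rightarrow> complex) \<Rightarrow> ('x \<times> nat \<Rightarrow> complex) \<Rightarrow> 'x \<times> nat \<Rightarrow> complex" where
  "adj_coef p m c = (\<lambda>(x, l). \<Sum>i<p. c (x, i) * m x i l)"

text \<open>The Pick form at c is s |f|^2 - |A f|^2, where f is the tuple with coefficients c and A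
  acts on coefficients by \<open>adj_coef\<close>. Positivity is therefore a norm bound on
  A.\<close>

lemma sesq_pick_kernel:
  "sesq (X \<times> {..<p}) (pick_kernel k s q m) c c =
     s * sesq (X \<times> {..<p}) (tuple_kernel k) c c
       - sesq (X \<times> {..<q}) (tuple_kernel k) (adj_coef p m c) (adj_coef p m c)"
proof -
  define f where "f = (\<lambda>i j l. c i * cnj (c j) * (k (fst i) (fst j) * (m (fst i) (snd i) l * cnj (m (fst j) (snd j) l))))"
  have "sesq (X \<times> {..<q}) (tuple_kernel k) (adj_coef p m c) (adj_coef p m c)
      = (\<Sum>l<q. \<Sum>x\<in>X. \<Sum>y\<in>X. \<Sum>i<p. \<Sum>j<p. f (x, i) (y, j) l)"
    unfolding sesq_tuple_kernel unfolding sesq_def adj_coef_def f_def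
    by (simp add: sum_product) (simp add: sum_distrib_left mult_ac)
  also have "\<dots> = (\<Sum>l<q. \<Sum>x\<in>X. \<Sum>i<p. \<Sum>y\<in>X. \<Sum>j<p. f (x, i) (y, j) l)"
    by (intro sum.cong refl sum.swap)
  also have "\<dots> = (\<Sum>l<q. \<Sum>i\<in>X \<times> {..<p}. \<Sum>j\<in>X \<times> {..<p}. f i j l)"
    unfolding sum.cartesian_product' ..
  also have "\<dots> = (\<Sum>i\<in>X \<times> {..<p}. \<Sum>j\<in>X \<times> {..<p}. \<Sum>l<q. f i j l)"
    by (subst sum.swap, intro sum.cong refl sum.swap)
  finally have "sesq (X \<times> {..<q}) (tuple_kernel k) (adj_coef p m c) (adj_coef p m c)
      = (\<Sum>i\<in>X \<times> {..<p}. \<Sum>j\<in>X \<times> {..<p}. \<Sum>l<q. f i j l)" .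
  moreover have "c i * cnj (c j) * pick_kernel k s q m i j
      = s * (c i * cnj (c j) * tuple_kernel k i j) - (\<Sum>l<q. f i j l)" for i j
  proof -
    have "a * (\<kappa> * (s * b - S)) = s * (a * (\<kappa> * b)) - a * (\<kappa> * S)" for a b \<kappa> S
      by (simp add: algebra_simps)
    then show ?thesis
      unfolding pick_kernel_def tuple_kernel_def f_def sum_distrib_left[symmetric] .
  qed
  ultimately show ?thesis
    by (simp add: sesq_def sum_subtractf sum_distrib_left)
qed

lemma psd_on_pick_kernel_iff:
  assumes k: "psd_on X k"
  shows "psd_on (X \<times> {..<p}) (pick_kernel k (of_real s) q m) \<longleftrightarrow>
    (\<forall>c. Re (sesq (X \<times> {..<q}) (tuple_kernel k) (adj_coef p m c) (adj_coef p m c))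
      \<le> s * Re (sesq (X \<times> {..<p}) (tuple_kernel k) c c))"
proof -
  have "pick_kernel k (of_real s) q m j i = cnj (pick_kernel k (of_real s) q m i j)"
    if "i \<in> X \<times> {..<p}" "j \<in> X \<times> {..<p}" for i j
  proof -
    have "k (fst j) (fst i) = cnj (k (fst i) (fst j))"
      using k that unfolding psd_on_def by (metis mem_Times_iff)
    moreover have "(\<Sum>l<q. m (fst j) (snd j) l * cnj (m (fst i) (snd i) l))
        = cnj (\<Sum>l<q. m (fst i) (snd i) l * cnj (m (fst j) (snd j) l))"
      by (simp add: mult.commute)
    moreover have "(of_bool (snd j = snd i) :: complex) = of_bool (snd i = snd j)" by auto
    ultimately show ?thesis unfolding pick_kernel_def by simp
  qed
  then have "psd_on (X \<times> {..<p}) (pick_kernel k (of_real s) q m) \<longleftrightarrow>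
      (\<forall>c. 0 \<le> Re (sesq (X \<times> {..<p}) (pick_kernel k (of_real s) q m) c c))"
    unfolding psd_on_def by blast
  then show ?thesis unfolding sesq_pick_kernel by simp
qed

section \<open>Multiplication operators on tuples: adjoints and norm bounds\<close>

definition kernel_tuple :: "'x function_space \<Rightarrow> ('x \<times> nat \<Rightarrow> complex) \<Rightarrow> nat \<Rightarrow> 'x \<Rightarrow> complex" where
  "kernel_tuple H c j = kcomb (ker H) (pts H) (\<lambda>x. c (x, j))"

lemma tuple_norm_cong: "(\<And>j. j < q \<Longrightarrow> g j = h j) \<Longrightarrow> tuple_norm H q g = tuple_norm H q h"
  by (simp add: tuple_norm_def)

lemma mult_op_cong:
  "(\<And>j. j < q \<Longrightarrow> g j = h j) \<Longrightarrow> mult_op H q M g = mult_op H q M h"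
  unfolding mult_op_def by (intro ext) simp

context
  fixes H :: "'x function_space"
  assumes H: "spanned_rkhs H"
begin

lemma spanned_facts: "rkhs H" "finite (pts H)" "psd_on (pts H) (ker H)"
  using H rkhs_psd[of H "pts H"] by (auto simp: spanned_rkhs_def)

lemma kernel_tuple_in: "kernel_tuple H c \<in> tuples H q"
  using rkhs_kcomb(1)[OF spanned_facts(1,2)] by (simp add: tuples_def kernel_tuple_def)

lemma tuple_coefs:
  assumes "h \<in> tuples H q"
  obtains d where "\<And>j. j < q \<Longrightarrow> h j = kernel_tuple H d j"
proof -
  have "\<exists>c. j < q \<longrightarrow> h j = kcomb (ker H) (pts H) c" for j
    using assms spanned_rkhs_funs[OF H] by (auto simp: tuples_def)
  then obtain c where "\<And>j. j < q \<Longrightarrow> h j = kcomb (ker H) (pts H) (c j)" by metis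
  then show ?thesis by (intro that[of "\<lambda>(x, j). c j x"]) (simp add: kernel_tuple_def)
qed

lemma sum_ip_kernel_tuple:
  "(\<Sum>j<q. ip H (kernel_tuple H c j) (kernel_tuple H d j))
     = sesq (pts H \<times> {..<q}) (tuple_kernel (ker H)) c d"
  by (simp add: kernel_tuple_def sesq_tuple_kernel rkhs_ip_kcomb_kcomb[OF spanned_facts(1,2)])

lemma tuple_norm_kernel_tuple:
  "tuple_norm H q (kernel_tuple H c) = sqrt (Re (sesq (pts H \<times> {..<q}) (tuple_kernel (ker H)) c c))"
  unfolding tuple_norm_def sum_ip_kernel_tuple[symmetric] Re_sum ..

text \<open>The relation <M f, g> = <f, A g> in coefficients, with A the adjoint. Both sides reduce
  to values of M f at the points paired with the coefficients of g.\<close>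

lemma mult_op_adjoint:
  assumes e: "\<And>i. i < p \<Longrightarrow> mult_op H q M (kernel_tuple H d) i = kernel_tuple H e i"
  shows "sesq (pts H \<times> {..<p}) (tuple_kernel (ker H)) e c
    = sesq (pts H \<times> {..<q}) (tuple_kernel (ker H)) d (adj_coef p (\<lambda>x i l. cnj (M x $$ (i, l))) c)"
proof -
  let ?X = "pts H"
  have ip: "ip H f (kernel_tuple H c i) = (\<Sum>y\<in>?X. f y * cnj (c (y, i)))" if "f \<in> funs H" for f c i
    using rkhs_kcomb(2)[OF spanned_facts(1,2) order_refl that] by (simp add: kernel_tuple_def)
  have kt: "kernel_tuple H c i \<in> funs H" for c i
    using kernel_tuple_in[of c "Suc i"] by (simp add: tuples_def)
  have "sesq (?X \<times> {..<p}) (tuple_kernel (ker H)) e c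
      = (\<Sum>i<p. \<Sum>y\<in>?X. mult_op H q M (kernel_tuple H d) i y * cnj (c (y, i)))"
    unfolding sum_ip_kernel_tuple[symmetric] by (simp add: ip kt e)
  also have "\<dots> = (\<Sum>i<p. \<Sum>y\<in>?X. \<Sum>l<q. M y $$ (i, l) * kernel_tuple H d l y * cnj (c (y, i)))"
    by (simp add: mult_op_def restrict0_def sum_distrib_right)
  also have "\<dots> = (\<Sum>y\<in>?X. \<Sum>i<p. \<Sum>l<q. M y $$ (i, l) * kernel_tuple H d l y * cnj (c (y, i)))"
    by (rule sum.swap)
  also have "\<dots> = (\<Sum>y\<in>?X. \<Sum>l<q. \<Sum>i<p. M y $$ (i, l) * kernel_tuple H d l y * cnj (c (y, i)))"
    by (intro sum.cong refl sum.swap)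
  also have "\<dots> = (\<Sum>l<q. \<Sum>y\<in>?X. \<Sum>i<p. M y $$ (i, l) * kernel_tuple H d l y * cnj (c (y, i)))"
    by (rule sum.swap)
  also have "\<dots> = sesq (?X \<times> {..<q}) (tuple_kernel (ker H)) d (adj_coef p (\<lambda>x i l. cnj (M x $$ (i, l))) c)"
    unfolding sum_ip_kernel_tuple[symmetric]
    by (simp add: ip kt adj_coef_def sum_distrib_left mult_ac)
  finally show ?thesis .
qed

text \<open>The right-hand side says that the adjoint, acting on kernel functions, is bounded by \<open>\<sigma>\<close>.\<close>

lemma contractive_iff_psd:
  assumes closed: "\<forall>h\<in>tuples H q. mult_op H q M h \<in> tuples H p" and "0 \<le> \<sigma>"
  shows "(\<forall>h\<in>tuples H q. tuple_norm H p (mult_op H q M h) \<le> \<sigma> * tuple_norm H q h) \<longleftrightarrow>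
    psd_on (pts H \<times> {..<p}) (pick_kernel (ker H) (of_real (\<sigma>\<^sup>2)) q (\<lambda>x i l. cnj (M x $$ (i, l))))"
proof -
  let ?T = "adj_coef p (\<lambda>x i l. cnj (M x $$ (i, l)))"
  define N where "N = (\<lambda>q c. Re (sesq (pts H \<times> {..<q}) (tuple_kernel (ker H)) c c))"
  have psd: "psd_on (pts H \<times> {..<q}) (tuple_kernel (ker H))" for q
    by (rule psd_on_tuple_kernel[OF spanned_facts(3)])
  have N_nonneg: "0 \<le> N q c" for q c unfolding N_def by (rule sesq_self(2)[OF psd])
  have norm: "tuple_norm H q (kernel_tuple H c) = sqrt (N q c)" for q c
    by (simp add: tuple_norm_kernel_tuple N_def)
  have CS: "(cmod (sesq (pts H \<times> {..<q}) (tuple_kernel (ker H)) c d))\<^sup>2 \<le> N q c * N q d" for q c d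
    unfolding N_def by (rule sesq_Cauchy_Schwarz[OF psd])
  have self: "cmod (sesq (pts H \<times> {..<q}) (tuple_kernel (ker H)) c c) = N q c" for q c
    using N_nonneg[of q c] unfolding N_def by (subst sesq_self(1)[OF psd]) simp
  have sqrt_le: "sqrt a \<le> \<sigma> * sqrt b \<longleftrightarrow> a \<le> \<sigma>\<^sup>2 * b" if "0 \<le> a" "0 \<le> b" for a b
    using \<open>0 \<le> \<sigma>\<close> by (metis real_sqrt_le_iff real_sqrt_mult real_sqrt_abs abs_of_nonneg)
  \<comment> \<open>The cancellation behind the equality of the norms of an operator and its
    adjoint: Cauchy-Schwarz bounds a^2 by a' b, the hypothesis bounds a' by \<sigma>^2 a, and one
    factor a is divided out.\<close>
  have cancel: "a \<le> \<sigma>\<^sup>2 * b" if "a\<^sup>2 \<le> a' * b" "a' \<le> \<sigma>\<^sup>2 * a" "0 \<le> a" "0 \<le> b" for a a' b :: real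
  proof (cases "a = 0")
    case False
    have "a * a \<le> a * (\<sigma>\<^sup>2 * b)"
      using that mult_right_mono[OF that(2,4)] by (simp add: power2_eq_square mult_ac)
    with False that(3) show ?thesis by simp
  qed (use that in simp)
  have coefs: "\<exists>e. (\<forall>i<p. mult_op H q M (kernel_tuple H d) i = kernel_tuple H e i) \<and>
      tuple_norm H p (mult_op H q M (kernel_tuple H d)) = sqrt (N p e)" for d
  proof -
    obtain e where e: "\<And>i. i < p \<Longrightarrow> mult_op H q M (kernel_tuple H d) i = kernel_tuple H e i"
      using tuple_coefs[OF closed[rule_format, OF kernel_tuple_in]] by metis
    have "tuple_norm H p (mult_op H q M (kernel_tuple H d)) = tuple_norm H p (kernel_tuple H e)"
      by (rule tuple_norm_cong) (rule e)
    with e show ?thesis by (auto simp: norm)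
  qed
  have "(\<forall>h\<in>tuples H q. tuple_norm H p (mult_op H q M h) \<le> \<sigma> * tuple_norm H q h) \<longleftrightarrow>
      (\<forall>d. tuple_norm H p (mult_op H q M (kernel_tuple H d)) \<le> \<sigma> * sqrt (N q d))"
  proof (intro iffI ballI allI)
    fix d assume "\<forall>h\<in>tuples H q. tuple_norm H p (mult_op H q M h) \<le> \<sigma> * tuple_norm H q h"
    then show "tuple_norm H p (mult_op H q M (kernel_tuple H d)) \<le> \<sigma> * sqrt (N q d)"
      using kernel_tuple_in[of d q] by (auto simp flip: norm)
  next
    fix h assume *: "\<forall>d. tuple_norm H p (mult_op H q M (kernel_tuple H d)) \<le> \<sigma> * sqrt (N q d)"
      and "h \<in> tuples H q"
    then obtain d where d: "\<And>j. j < q \<Longrightarrow> h j = kernel_tuple H d j" using tuple_coefs by metis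
    have "mult_op H q M h = mult_op H q M (kernel_tuple H d)" by (rule mult_op_cong) (rule d)
    moreover have "tuple_norm H q h = tuple_norm H q (kernel_tuple H d)"
      by (rule tuple_norm_cong) (rule d)
    ultimately show "tuple_norm H p (mult_op H q M h) \<le> \<sigma> * tuple_norm H q h" using * by (simp add: norm)
  qed
  also have "\<dots> \<longleftrightarrow> (\<forall>c. N q (?T c) \<le> \<sigma>\<^sup>2 * N p c)"
  proof (intro iffI allI)
    fix c assume *: "\<forall>d. tuple_norm H p (mult_op H q M (kernel_tuple H d)) \<le> \<sigma> * sqrt (N q d)"
    \<comment> \<open>The bound on M is tested on the adjoint image of c, whose squared norm is the
      pairing of its M-image with c.\<close>
    obtain e where e: "\<And>i. i < p \<Longrightarrow> mult_op H q M (kernel_tuple H (?T c)) i = kernel_tuple H e i"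
      and n: "tuple_norm H p (mult_op H q M (kernel_tuple H (?T c))) = sqrt (N p e)"
      using coefs[of "?T c"] by blast
    have "sesq (pts H \<times> {..<p}) (tuple_kernel (ker H)) e c
        = sesq (pts H \<times> {..<q}) (tuple_kernel (ker H)) (?T c) (?T c)"
      by (rule mult_op_adjoint) (rule e)
    then have "(N q (?T c))\<^sup>2 \<le> N p e * N p c" using CS[of p e c] by (simp only: self)
    moreover have "N p e \<le> \<sigma>\<^sup>2 * N q (?T c)"
      using *[rule_format, of "?T c"] sqrt_le[OF N_nonneg N_nonneg] by (simp add: n)
    ultimately show "N q (?T c) \<le> \<sigma>\<^sup>2 * N p c" using cancel N_nonneg by blast
  next
    fix d assume *: "\<forall>c. N q (?T c) \<le> \<sigma>\<^sup>2 * N p c"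
    obtain e where e: "\<And>i. i < p \<Longrightarrow> mult_op H q M (kernel_tuple H d) i = kernel_tuple H e i"
      and n: "tuple_norm H p (mult_op H q M (kernel_tuple H d)) = sqrt (N p e)"
      using coefs[of d] by blast
    \<comment> \<open>Dually, the bound on the adjoint is tested on e, the coefficients of the
      M-image of d.\<close>
    have "sesq (pts H \<times> {..<p}) (tuple_kernel (ker H)) e e
        = sesq (pts H \<times> {..<q}) (tuple_kernel (ker H)) d (?T e)"
      by (rule mult_op_adjoint) (rule e)
    then have "(N p e)\<^sup>2 \<le> N q (?T e) * N q d"
      using CS[of q d "?T e"] self[of p e] by (simp only: mult.commute)
    then have "N p e \<le> \<sigma>\<^sup>2 * N q d" using cancel N_nonneg * by blast
    then show "tuple_norm H p (mult_op H q M (kernel_tuple H d)) \<le> \<sigma> * sqrt (N q d)"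
      using sqrt_le[OF N_nonneg N_nonneg] by (simp add: n)
  qed
  also have "\<dots> \<longleftrightarrow> psd_on (pts H \<times> {..<p}) (pick_kernel (ker H) (of_real (\<sigma>\<^sup>2)) q (\<lambda>x i l. cnj (M x $$ (i, l))))"
    unfolding psd_on_pick_kernel_iff[OF spanned_facts(3)] N_def ..
  finally show ?thesis .
qed

lemma tuple_scale:
  assumes "h \<in> tuples H q"
  shows "(\<lambda>j x. of_real a * h j x) \<in> tuples H q"
    and "tuple_norm H q (\<lambda>j x. of_real a * h j x) = \<bar>a\<bar> * tuple_norm H q h"
proof -
  note ips = rkhs_ips[OF spanned_facts(1)]
  have h: "h j \<in> funs H" if "j < q" for j using assms that by (simp add: tuples_def)
  have ah: "(\<lambda>x. of_real a * h j x) \<in> funs H" if "j < q" for j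
    by (intro cfun.subspace_scale[OF ips_subspace[OF ips]] h that)
  then show "(\<lambda>j x. of_real a * h j x) \<in> tuples H q" by (simp add: tuples_def)
  have "ip H (\<lambda>x. of_real a * h j x) (\<lambda>x. of_real a * h j x) = of_real (a\<^sup>2) * ip H (h j) (h j)"
    if "j < q" for j
  proof -
    have "ip H (\<lambda>x. of_real a * h j x) (\<lambda>x. of_real a * h j x)
        = of_real a * cnj (ip H (\<lambda>x. of_real a * h j x) (h j))"
      by (simp only: ips_scale[OF ips h[OF that] ah[OF that]] ips_cnj[OF ips ah[OF that] h[OF that]])
    also have "\<dots> = of_real (a\<^sup>2) * cnj (ip H (h j) (h j))"
      by (simp add: ips_scale[OF ips h[OF that] h[OF that]] power2_eq_square)
    finally show ?thesis using ips_cnj[OF ips h[OF that] h[OF that]] by simp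
  qed
  then have "(\<Sum>j<q. Re (ip H (\<lambda>x. of_real a * h j x) (\<lambda>x. of_real a * h j x)))
      = a\<^sup>2 * (\<Sum>j<q. Re (ip H (h j) (h j)))"
    unfolding sum_distrib_left by (intro sum.cong refl) (simp flip: of_real_power)
  then show "tuple_norm H q (\<lambda>j x. of_real a * h j x) = \<bar>a\<bar> * tuple_norm H q h"
    by (simp add: tuple_norm_def real_sqrt_mult)
qed

lemma tuple_norm_nonneg: "h \<in> tuples H q \<Longrightarrow> 0 \<le> tuple_norm H q h"
  using ips_nonneg[OF rkhs_ips[OF spanned_facts(1)]]
  by (auto simp: tuple_norm_def tuples_def intro!: sum_nonneg)

lemma mult_op_scale:
  "mult_op H q M (\<lambda>j x. of_real a * h j x) = (\<lambda>i x. of_real a * mult_op H q M h i x)"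
  unfolding mult_op_def restrict0_def by (intro ext) (simp add: sum_distrib_left mult_ac)

lemma multiplier_bound:
  assumes mult: "is_multiplier H p q M" and h: "h \<in> tuples H q"
  shows "tuple_norm H p (mult_op H q M h) \<le> multiplier_norm H p q M * tuple_norm H q h"
proof -
  have Mh: "mult_op H q M h \<in> tuples H p" using mult h by (simp add: is_multiplier_def)
  have unit: "tuple_norm H p (mult_op H q M g) \<le> multiplier_norm H p q M"
    if "g \<in> tuples H q" "tuple_norm H q g \<le> 1" for g
    unfolding multiplier_norm_def
    using mult that by (intro cSup_upper) (auto simp: mult_unit_values_def is_multiplier_def)
  have scaled: "\<bar>a\<bar> * tuple_norm H p (mult_op H q M h) \<le> multiplier_norm H p q M"
    if "\<bar>a\<bar> * tuple_norm H q h \<le> 1" for a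
    using unit[OF tuple_scale(1)[OF h, of a]] that
    by (simp add: tuple_scale(2)[OF h] mult_op_scale tuple_scale(2)[OF Mh])
  note n = tuple_norm_nonneg[OF h] tuple_norm_nonneg[OF Mh]
  show ?thesis
  proof (cases "tuple_norm H q h = 0")
    case True
    have "tuple_norm H p (mult_op H q M h) = 0"
    proof (rule ccontr)
      assume "tuple_norm H p (mult_op H q M h) \<noteq> 0"
      \<comment> \<open>All multiples of a tuple of norm 0 lie in the unit ball; the image of this
        one would have norm \<open>\<bar>multiplier_norm H p q M\<bar> + 1\<close>, above the
        supremum.\<close>
      with n scaled[of "(\<bar>multiplier_norm H p q M\<bar> + 1) / tuple_norm H p (mult_op H q M h)"] True
      show False by simp
    qed
    with True show ?thesis by simp
  next
    case False
    with n scaled[of "1 / tuple_norm H q h"] show ?thesis by (simp add: field_simps)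
  qed
qed

lemma zero_tuple: "(\<lambda>_ _. 0) \<in> tuples H q" "tuple_norm H q (\<lambda>_ _. 0) = 0"
proof -
  have "kernel_tuple H (\<lambda>_. 0) = (\<lambda>_ _. 0)" by (auto simp: kernel_tuple_def kcomb_def)
  then show "(\<lambda>_ _. 0) \<in> tuples H q" "tuple_norm H q (\<lambda>_ _. 0) = 0"
    using kernel_tuple_in[of "\<lambda>_. 0"] tuple_norm_kernel_tuple[of q "\<lambda>_. 0"]
    by (simp_all add: sesq_def)
qed

lemma multiplier_normI:
  assumes "\<And>h. h \<in> tuples H q \<Longrightarrow> tuple_norm H p (mult_op H q M h) \<le> \<sigma> * tuple_norm H q h"
    and "0 \<le> \<sigma>"
  shows "bdd_above (mult_unit_values H p q M)" and "multiplier_norm H p q M \<le> \<sigma>"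
proof -
  have le: "v \<le> \<sigma>" if "v \<in> mult_unit_values H p q M" for v
    using that assms mult_left_mono[of _ 1 \<sigma>] by (fastforce simp: mult_unit_values_def)
  then show "bdd_above (mult_unit_values H p q M)" by (rule bdd_aboveI)
  have "mult_unit_values H p q M \<noteq> {}"
    using zero_tuple[of q] by (force simp: mult_unit_values_def)
  then show "multiplier_norm H p q M \<le> \<sigma>"
    unfolding multiplier_norm_def using le by (rule cSup_least)
qed

lemma multiplier_norm_nonneg:
  assumes "is_multiplier H p q M"
  shows "0 \<le> multiplier_norm H p q M"
proof -
  have "mult_op H q M (\<lambda>_ _. 0) \<in> tuples H p" 
    using assms zero_tuple(1)[of q] by (simp add: is_multiplier_def)
  then have "0 \<le> tuple_norm H p (mult_op H q M (\<lambda>_ _. 0))" by (rule tuple_norm_nonneg)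
  also have "\<dots> \<le> multiplier_norm H p q M"
    unfolding multiplier_norm_def
    using assms zero_tuple[of q]
    by (intro cSup_upper) (auto simp: mult_unit_values_def is_multiplier_def intro!: exI[of _ "\<lambda>_ _. 0"])
  finally show ?thesis .
qed

end

text \<open>The tree enters the Pick property only through the map \<phi> into the ball.
  Contractivity on Y is translated into positivity of the Pick kernel, extended, and translated
  back.\<close>

theorem complete_pick_of_ball_embedding:
  fixes H :: "'x function_space" and \<phi> :: "'x \<Rightarrow> 'v \<Rightarrow> complex"
  assumes H: "finite_rkhs H" and V: "finite V"
    and ball: "\<And>x. x \<in> pts H \<Longrightarrow> (\<Sum>v\<in>V. (cmod (\<phi> x v))\<^sup>2) < 1"
    and k: "\<And>x y. x \<in> pts H \<Longrightarrow> y \<in> pts H \<Longrightarrow> ker H x y * (1 - (\<Sum>v\<in>V. \<phi> x v * cnj (\<phi> y v))) = 1"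
  shows "complete_pick H"
  unfolding complete_pick_def
proof (intro allI impI, elim conjE)
  fix Y p q M
  assume Y: "Y \<subseteq> pts H" and M: "is_multiplier (rkhs_sub H Y) p q M"
    and norm_M: "multiplier_norm (rkhs_sub H Y) p q M = 1"
  note sH = finite_rkhs_spanned[OF H]
  note facts = spanned_facts[OF sH]
  have fin_Y: "finite Y" using Y facts(2) by (rule finite_subset)
  have sY: "spanned_rkhs (rkhs_sub H Y)" by (rule spanned_rkhs_sub[OF facts(1) fin_Y Y])
  let ?conj = "\<lambda>M x i l. cnj (M x $$ (i, l))"
  have Y_kernel: "psd_on (Y \<times> {..<p}) (pick_kernel (ker (rkhs_sub H Y)) s q m)
      \<longleftrightarrow> psd_on (Y \<times> {..<p}) (pick_kernel (ker H) s q m)" for s m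
    by (rule psd_on_cong) (auto simp: pick_kernel_def restrict0_def)
  have closed_Y: "\<forall>h\<in>tuples (rkhs_sub H Y) q. mult_op (rkhs_sub H Y) q M h \<in> tuples (rkhs_sub H Y) p"
    using M by (simp add: is_multiplier_def)
  note iff_Y = contractive_iff_psd[OF sY closed_Y, unfolded rkhs_sub_simps(1) Y_kernel]
  have "psd_on (Y \<times> {..<p}) (pick_kernel (ker H) 1 q (?conj M))"
    using iff_Y[of 1] multiplier_bound[OF sY M] by (simp add: norm_M)
  then obtain m' where m': "\<And>y i l. y \<in> Y \<Longrightarrow> i < p \<Longrightarrow> l < q \<Longrightarrow> m' y i l = cnj (M y $$ (i, l))"
    and psd: "psd_on (pts H \<times> {..<p}) (pick_kernel (ker H) 1 q m')"
    using pick_extension[OF facts(2) V Y ball k facts(3)] by blast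
  \<comment> \<open>On Y the given matrices are kept, so agreement is literal; elsewhere the
    conjugate undoes the passage to the adjoint. The entries of M on Y are also the conjugates of
    those of m', so the Pick kernel of N is the extended one everywhere.\<close>
  define N where "N = (\<lambda>x. if x \<in> Y then M x else mat p q (\<lambda>(i, l). cnj (m' x i l)))"
  have N_Y: "N y = M y" if "y \<in> Y" for y using that by (simp add: N_def)
  have "M y \<in> carrier_mat p q" if "y \<in> Y" for y using M that by (simp add: is_multiplier_def)
  then have N_carrier: "N x \<in> carrier_mat p q" for x by (simp add: N_def)
  have N_entry: "cnj (N x $$ (i, l)) = m' x i l" if "i < p" "l < q" for x i l
    using that m' by (simp add: N_def)
  have closed: "\<forall>h\<in>tuples H q. mult_op H q N h \<in> tuples H p"
    using finite_rkhs_funs[OF H] by (simp add: tuples_def mult_op_def restrict0_def)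
  note iff = contractive_iff_psd[OF sH closed]
  have "psd_on (pts H \<times> {..<p}) (pick_kernel (ker H) 1 q (?conj N)) \<longleftrightarrow>
      psd_on (pts H \<times> {..<p}) (pick_kernel (ker H) 1 q m')"
    by (rule psd_on_cong) (auto simp: pick_kernel_def N_entry simp flip: N_entry)
  with psd iff[of 1] have "tuple_norm H p (mult_op H q N h) \<le> 1 * tuple_norm H q h"
    if "h \<in> tuples H q" for h using that by simp
  from multiplier_normI[OF sH this] have bdd: "bdd_above (mult_unit_values H p q N)"
    and le: "multiplier_norm H p q N \<le> 1" by simp_all
  have N: "is_multiplier H p q N"
    using N_carrier closed bdd by (simp add: is_multiplier_def)
  \<comment> \<open>The lower bound for the norm: \<sigma> bounds N on H, hence, by restricting the
    Pick kernel to Y where N = M, it bounds M, whose norm is 1.\<close>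
  define \<sigma> where "\<sigma> = multiplier_norm H p q N"
  have \<sigma>: "0 \<le> \<sigma>" using multiplier_norm_nonneg[OF sH N] by (simp add: \<sigma>_def)
  have "psd_on (pts H \<times> {..<p}) (pick_kernel (ker H) (of_real (\<sigma>\<^sup>2)) q (?conj N))"
    using iff[OF \<sigma>] multiplier_bound[OF sH N] by (simp add: \<sigma>_def)
  then have "psd_on (Y \<times> {..<p}) (pick_kernel (ker H) (of_real (\<sigma>\<^sup>2)) q (?conj N))"
    by (rule psd_on_subset) (use Y facts(2) in auto)
  also have "?this \<longleftrightarrow> psd_on (Y \<times> {..<p}) (pick_kernel (ker H) (of_real (\<sigma>\<^sup>2)) q (?conj M))"
    by (rule psd_on_cong) (auto simp: pick_kernel_def N_Y)
  finally have "tuple_norm (rkhs_sub H Y) p (mult_op (rkhs_sub H Y) q M h) \<le> \<sigma> * tuple_norm (rkhs_sub H Y) q h"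
    if "h \<in> tuples (rkhs_sub H Y) q" for h using iff_Y[OF \<sigma>] that by simp
  from multiplier_normI(2)[OF sY this \<sigma>] have "1 \<le> \<sigma>" by (simp add: norm_M)
  with le N N_Y show "\<exists>N. is_multiplier H p q N \<and> multiplier_norm H p q N = 1 \<and> (\<forall>y\<in>Y. N y = M y)"
    by (intro exI[of _ N]) (simp add: \<sigma>_def)
qed

section \<open>Segments and meets in a rooted tree\<close>

lemma vpath_with_proj_iff:
  "vpath p (with_proj T) \<longleftrightarrow> set p \<subseteq> pverts T \<and> set (vwalk_arcs p) \<subseteq> parcs T \<and> p \<noteq> [] \<and> distinct p"
  by (auto simp: vpath_def vwalk_def)

context
  fixes T :: "'v pair_pre_digraph" and r :: 'v
  assumes tree: "finite_rooted_tree T r"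
begin

abbreviation "tpath p \<equiv> vpath p (with_proj T)"

lemma tree_finite: "finite (pverts T)"
proof -
  interpret pair_graph T using tree by (simp add: finite_rooted_tree_def)
  show ?thesis by simp
qed

lemma tree_root: "r \<in> pverts T"
  using tree by (simp add: finite_rooted_tree_def)

lemma tree_sym: "(u, v) \<in> parcs T \<Longrightarrow> (v, u) \<in> parcs T"
proof -
  interpret pair_graph T using tree by (simp add: finite_rooted_tree_def)
  assume "(u, v) \<in> parcs T"
  then show ?thesis using arcs_symmetric by auto
qed

lemma tree_acyclic: "tpath p \<Longrightarrow> 3 \<le> length p \<Longrightarrow> (last p, hd p) \<notin> parcs T"
  using tree unfolding finite_rooted_tree_def by blast

lemma tpath_exists:
  assumes "u \<in> pverts T" "v \<in> pverts T"
  obtains p where "tpath p" "hd p = u" "last p = v"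
proof -
  interpret pair_graph T using tree by (simp add: finite_rooted_tree_def)
  \<comment> \<open>Connectedness is defined through the symmetric closure, which has the same
    reachability as the symmetric graph T.\<close>
  have "strongly_connected (with_proj (mk_symmetric (with_proj T)))"
    using tree by (simp add: finite_rooted_tree_def connected_def)
  then have "u \<rightarrow>\<^sup>*\<^bsub>with_proj (mk_symmetric (with_proj T))\<^esub> v"
    using assms by (auto simp: strongly_connected_def)
  then have "u \<rightarrow>\<^sup>*\<^bsub>with_proj T\<^esub> v"
    using reachable_mk_symmetric_eq[OF sym_arcs, of u v] by simp
  then obtain q where "vwalk q (with_proj T)" "hd q = u" "last q = v"
    by (auto simp: reachable_vwalk_conv)
  from vwalk_imp_ex_vpath[OF this] that show thesis by blast
qed

lemma tpath_prefix: "tpath (p @ q) \<Longrightarrow> p \<noteq> [] \<Longrightarrow> tpath p"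
  using set_vwalk_arcs_append1[of p q] by (auto simp: vpath_with_proj_iff)

lemma tpath_suffix: "tpath (p @ q) \<Longrightarrow> q \<noteq> [] \<Longrightarrow> tpath q"
  using set_vwalk_arcs_append2[of q p] by (auto simp: vpath_with_proj_iff)

lemma tpath_rev: "tpath p \<Longrightarrow> tpath (rev p)"
  using tree_sym by (auto simp: vpath_with_proj_iff set_vwalk_arcs_rev)

lemma tpath_append:
  assumes "tpath p" "tpath q" "(last p, hd q) \<in> parcs T" "set p \<inter> set q = {}"
  shows "tpath (p @ q)"
  using assms by (auto simp: vpath_with_proj_iff vwalk_arcs_append)

lemma tpath_arc: "tpath (p @ q) \<Longrightarrow> p \<noteq> [] \<Longrightarrow> q \<noteq> [] \<Longrightarrow> (last p, hd q) \<in> parcs T"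
  by (auto simp: vpath_with_proj_iff vwalk_arcs_append)

text \<open>If the paths separate after the vertex a, following the first to where it meets the
  second again and returning along the reversed second path closes a cycle through a.\<close>

lemma tpath_unique:
  assumes "tpath p" "tpath q" "hd p = hd q" "last p = last q"
  shows "p = q"
  using assms
proof (induction p arbitrary: q)
  case Nil
  then show ?case by (simp add: vpath_with_proj_iff)
next
  case (Cons a p')
  obtain q' where q: "q = a # q'"
    using Cons.prems by (cases q) (auto simp: vpath_with_proj_iff)
  have a: "a \<notin> set p'" "a \<notin> set q'"
    using Cons.prems by (auto simp: q vpath_with_proj_iff)
  show ?case
  proof (cases "p' = [] \<or> q' = []")
    case True
    with a Cons.prems(4) q show ?thesis
      by (metis last.simps last_in_set)
  next
    case False
    have p': "tpath p'" and q': "tpath q'"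
      using Cons.prems False tpath_suffix[of "[a]"] by (auto simp: q)
    have last: "last p' = last q'" using Cons.prems(4) False by (simp add: q)
    have "hd p' = hd q'"
    proof (rule ccontr)
      assume ne: "hd p' \<noteq> hd q'"
      have "\<exists>z\<in>set p'. z \<in> set q'" using last False by (metis last_in_set)
      \<comment> \<open>Taking the first common vertex z keeps p1 disjoint from q', so the closed
        walk repeats no vertex.\<close>
      then obtain p1 z p2 where p1: "p' = p1 @ z # p2" "z \<in> set q'" "\<forall>y\<in>set p1. y \<notin> set q'"
        using split_list_first_prop[of p' "\<lambda>z. z \<in> set q'"] by auto
      obtain q1 q2 where q1: "q' = q1 @ z # q2" using p1(2) by (auto simp: in_set_conv_decomp)
      define c where "c = a # p1 @ z # rev q1"
      have "tpath (a # p1 @ [z])"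
        using tpath_prefix[of "a # p1 @ [z]" p2] Cons.prems(1) by (simp add: p1)
      moreover have "tpath c" if "q1 = []"
        using that calculation by (simp add: c_def)
      moreover have "tpath c" if "q1 \<noteq> []"
      proof -
        have "tpath (rev q1)"
          using tpath_prefix[of q1] tpath_rev q' that by (simp add: q1)
        moreover have "(z, hd (rev q1)) \<in> parcs T"
          using tpath_arc[of q1 "z # q2"] q' that tree_sym by (simp add: q1 hd_rev)
        moreover have "set (a # p1 @ [z]) \<inter> set (rev q1) = {}"
          using a p1 q' by (auto simp: q1 vpath_with_proj_iff)
        ultimately show ?thesis
          using tpath_append[of "a # p1 @ [z]" "rev q1"] \<open>tpath (a # p1 @ [z])\<close>
          by (simp add: c_def)
      qed
      ultimately have "tpath c" by blast
      moreover have "(last c, hd c) \<in> parcs T"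
      proof -
        have "last c = hd q'" by (cases q1) (simp_all add: c_def q1)
        moreover have "(a, hd q') \<in> parcs T"
          using tpath_arc[of "[a]" q'] Cons.prems(2) False by (simp add: q)
        ultimately show ?thesis using tree_sym by (simp add: c_def)
      qed
      \<comment> \<open>The first steps differ, so z cannot be the successor of a on both paths and
        one of p1, q1 is nonempty.\<close>
      moreover have "3 \<le> length c"
        using ne by (cases p1; cases q1) (simp_all add: c_def p1 q1)
      ultimately show False using tree_acyclic by blast
    qed
    with Cons.IH[OF p' q' _ last] q show ?thesis by simp
  qed
qed

section \<open>Root paths, the tree order and meets\<close>

definition root_path :: "'v \<Rightarrow> 'v list" where
  "root_path x = (THE p. tpath p \<and> hd p = r \<and> last p = x)"

lemma segment_root: "segment T r x = set (root_path x)"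
  by (simp add: segment_def root_path_def)

lemma root_path_eq: "tpath p \<Longrightarrow> hd p = r \<Longrightarrow> root_path (last p) = p"
  unfolding root_path_def by (rule the_equality) (auto intro: tpath_unique)

lemma root_path:
  assumes "x \<in> pverts T"
  shows "tpath (root_path x)" "hd (root_path x) = r" "last (root_path x) = x" "root_path x \<noteq> []"
proof -
  obtain p where "tpath p" "hd p = r" "last p = x"
    using tpath_exists[OF tree_root assms] by blast
  moreover from this have "root_path x = p" using root_path_eq by blast
  ultimately show "tpath (root_path x)" "hd (root_path x) = r" "last (root_path x) = x"
      "root_path x \<noteq> []"
    by (auto simp: vpath_with_proj_iff)
qed

lemma root_path_prefix:
  assumes "x \<in> pverts T" "root_path x = p @ v # q"
  shows "root_path v = p @ [v]"
proof -
  have "tpath (p @ [v])"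
    using tpath_prefix[of "p @ [v]" q] root_path(1)[OF assms(1)] assms(2) by simp
  moreover have "hd (p @ [v]) = r" using root_path(2)[OF assms(1)] assms(2) by (cases p) auto
  ultimately show ?thesis using root_path_eq[of "p @ [v]"] by simp
qed

lemma segment_self: "x \<in> pverts T \<Longrightarrow> x \<in> segment T r x"
  using root_path(3,4)[of x] last_in_set[of "root_path x"] by (simp add: segment_root)

lemma segment_in_verts: "x \<in> pverts T \<Longrightarrow> segment T r x \<subseteq> pverts T"
  using root_path(1)[of x] by (auto simp: segment_root vpath_with_proj_iff)

text \<open>Turns the tree order into the prefix order on lists, from which transitivity,
  antisymmetry and the existence of meets are inherited.\<close>

lemma mem_segment_iff_prefix:
  assumes "x \<in> pverts T" "v \<in> pverts T"
  shows "v \<in> segment T r x \<longleftrightarrow> prefix (root_path v) (root_path x)"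
proof
  assume "v \<in> segment T r x"
  then obtain p q where "root_path x = p @ v # q"
    by (auto simp: segment_root in_set_conv_decomp)
  with root_path_prefix[OF assms(1)] show "prefix (root_path v) (root_path x)" by simp
next
  assume "prefix (root_path v) (root_path x)"
  then show "v \<in> segment T r x"
    using segment_self[OF assms(2)] set_mono_prefix by (auto simp: segment_root)
qed

lemma segment_trans:
  assumes "x \<in> pverts T" "v \<in> segment T r x"
  shows "segment T r v \<subseteq> segment T r x"
proof -
  have "v \<in> pverts T" using assms segment_in_verts by blast
  with assms mem_segment_iff_prefix show ?thesis
    by (auto simp: segment_root dest: set_mono_prefix)
qed

lemma segment_antisym:
  assumes "x \<in> pverts T" "v \<in> segment T r x" "x \<in> segment T r v"
  shows "x = v"
proof -
  have "v \<in> pverts T" using assms segment_in_verts by blast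
  with assms have "root_path v = root_path x"
    using mem_segment_iff_prefix prefix_order.antisym by blast
  then show ?thesis using root_path(3) assms(1) \<open>v \<in> pverts T\<close> by metis
qed

lemma segment_root_self: "segment T r r = {r}"
proof -
  have "tpath [r]" using tree_root by (simp add: vpath_with_proj_iff)
  then show ?thesis using root_path_eq[of "[r]"] by (simp add: segment_root)
qed

text \<open>The meet is the last vertex of the longest common prefix of the two root paths, which is
  nonempty because both start at the root.\<close>

lemma
  assumes x: "x \<in> pverts T" and y: "y \<in> pverts T"
  shows tree_meet_in_verts: "tree_meet T r x y \<in> pverts T"
    and segment_meet: "segment T r (tree_meet T r x y) = segment T r x \<inter> segment T r y"
proof -
  define l where "l = longest_common_prefix (root_path x) (root_path y)"
  define z where "z = last l"
  have l: "prefix l (root_path x)" "prefix l (root_path y)"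
    unfolding l_def by (simp_all add: longest_common_prefix_prefix1 longest_common_prefix_prefix2)
  have "l \<noteq> []"
    using root_path[OF x] root_path[OF y] unfolding l_def
    by (cases "root_path x"; cases "root_path y") auto
  then obtain p where p: "l = p @ [z]" unfolding z_def by (metis append_butlast_last_id)
  then obtain q where q: "root_path x = p @ z # q" using l(1) by (auto simp: prefix_def)
  have rz: "root_path z = l" using root_path_prefix[OF x q] p by simp
  have z: "z \<in> pverts T" using q x root_path(1)[OF x] by (auto simp: vpath_with_proj_iff)
  have seg: "segment T r z = segment T r x \<inter> segment T r y"
  proof
    show "segment T r z \<subseteq> segment T r x \<inter> segment T r y"
      using l rz by (auto simp: segment_root dest: set_mono_prefix)
    show "segment T r x \<inter> segment T r y \<subseteq> segment T r z"
    proof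
      fix v assume v: "v \<in> segment T r x \<inter> segment T r y"
      then have vT: "v \<in> pverts T" using segment_in_verts[OF x] by blast
      with v x y have "prefix (root_path v) (root_path x)" "prefix (root_path v) (root_path y)"
        by (auto simp: mem_segment_iff_prefix)
      then have "prefix (root_path v) (root_path z)"
        unfolding rz l_def by (rule longest_common_prefix_max_prefix)
      then show "v \<in> segment T r z" using mem_segment_iff_prefix vT z by blast
    qed
  qed
  \<comment> \<open>Since the intersection is itself the segment of z, every other vertex in it lies
    below z, and the maximal element is unique.\<close>
  have "tree_meet T r x y = z"
    unfolding tree_meet_def seg[symmetric]
  proof (rule the_equality)
    show "z \<in> segment T r z \<and> \<not> (\<exists>w\<in>segment T r z. tree_less T r z w)"
      using segment_self[OF z] segment_antisym[OF z] by (auto simp: tree_less_def)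
    fix w assume "w \<in> segment T r z \<and> \<not> (\<exists>v\<in>segment T r z. tree_less T r w v)"
    then show "w = z" using segment_self[OF z] by (auto simp: tree_less_def)
  qed
  with z seg show "tree_meet T r x y \<in> pverts T"
      "segment T r (tree_meet T r x y) = segment T r x \<inter> segment T r y"
    by auto
qed

definition parent :: "'v \<Rightarrow> 'v" where
  "parent x = last (butlast (root_path x))"

lemma segment_parent:
  assumes "x \<in> pverts T" "x \<noteq> r"
  shows "parent x \<in> pverts T" "x \<notin> segment T r (parent x)"
    "segment T r x = insert x (segment T r (parent x))"
proof -
  define p where "p = butlast (root_path x)"
  have eq: "root_path x = p @ [x]"
    using root_path(3,4)[OF assms(1)] unfolding p_def by (metis append_butlast_last_id)
  moreover have "p \<noteq> []" using eq root_path(2)[OF assms(1)] assms(2) by (cases p) auto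
  ultimately have eq2: "root_path x = butlast p @ parent x # [x]"
    by (simp add: parent_def flip: p_def)
  have rp: "root_path (parent x) = p"
    using root_path_prefix[OF assms(1) eq2] \<open>p \<noteq> []\<close>
    by (simp add: parent_def flip: p_def)
  have "distinct (root_path x)" using root_path(1)[OF assms(1)] by (simp add: vpath_def)
  then show "x \<notin> segment T r (parent x)" by (simp add: eq segment_root rp)
  show "segment T r x = insert x (segment T r (parent x))" by (simp add: eq segment_root rp)
  show "parent x \<in> pverts T"
    using root_path(1)[OF assms(1)] by (auto simp: eq2 vpath_with_proj_iff)
qed

text \<open>At the root, \<open>parent\<close> is \<open>last []\<close> and carries no meaning, so
  the root is treated apart. It receives f r itself, which makes sums along root segments telescope
  to f x rather than f x - f r.\<close>

definition increment :: "('v \<Rightarrow> 'b::ab_group_add) \<Rightarrow> 'v \<Rightarrow> 'b" where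
  "increment f x = (if x = r then f r else f x - f (parent x))"

lemma finite_segment: "finite (segment T r x)"
  by (simp add: segment_root)

lemma sum_increment:
  assumes "x \<in> pverts T"
  shows "(\<Sum>v\<in>segment T r x. increment f v) = f x"
  using assms
proof (induction "card (segment T r x)" arbitrary: x rule: less_induct)
  case less
  show ?case
  proof (cases "x = r")
    case True
    then show ?thesis by (simp add: segment_root_self increment_def)
  next
    case False
    note par = segment_parent[OF less.prems False]
    have "card (segment T r (parent x)) < card (segment T r x)"
      using par(2) by (simp add: par(3) finite_segment)
    with less.hyps par(1) have "(\<Sum>v\<in>segment T r (parent x). increment f v) = f (parent x)" by blast
    with par(2) False show ?thesis by (simp add: par(3) finite_segment increment_def)
  qed
qed

lemma tree_less_parent:
  assumes "x \<in> pverts T" "x \<noteq> r"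
  shows "tree_less T r (parent x) x"
  using segment_parent[OF assms] segment_self[of "parent x"] by (auto simp: tree_less_def)

end

section \<open>Gram representation of kernels that depend on the meet\<close>

definition tree_feature :: "'v pair_pre_digraph \<Rightarrow> 'v \<Rightarrow> ('v \<Rightarrow> real) \<Rightarrow> 'v \<Rightarrow> 'v \<Rightarrow> complex" where
  "tree_feature T r f x v = of_real (if v \<in> segment T r x then sqrt (increment T r f v) else 0)"

context
  fixes T :: "'v pair_pre_digraph" and r :: 'v
  assumes tree: "finite_rooted_tree T r"
begin

lemma tree_meet_commute: "tree_meet T r x y = tree_meet T r y x"
  by (simp add: tree_meet_def Int_commute)

lemma tree_meet_self: "x \<in> pverts T \<Longrightarrow> tree_meet T r x x = x"
  using segment_meet[OF tree, of x x] tree_meet_in_verts[OF tree, of x x]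
    segment_self[OF tree] segment_antisym[OF tree, of x "tree_meet T r x x"] by fastforce

lemma tree_feature_gram:
  assumes x: "x \<in> pverts T" and y: "y \<in> pverts T"
    and nonneg: "\<And>v. v \<in> pverts T \<Longrightarrow> 0 \<le> increment T r f v"
  shows "(\<Sum>v\<in>pverts T. tree_feature T r f x v * cnj (tree_feature T r f y v))
    = of_real (f (tree_meet T r x y))"
proof -
  let ?m = "tree_meet T r x y"
  have m: "?m \<in> pverts T" by (rule tree_meet_in_verts[OF tree x y])
  have "(\<Sum>v\<in>pverts T. tree_feature T r f x v * cnj (tree_feature T r f y v))
      = (\<Sum>v\<in>pverts T. if v \<in> segment T r ?m then of_real (increment T r f v) else 0)"
    by (intro sum.cong refl)
      (auto simp: tree_feature_def segment_meet[OF tree x y] nonneg simp flip: of_real_mult)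
  also have "\<dots> = (\<Sum>v\<in>segment T r ?m. of_real (increment T r f v))"
    using segment_in_verts[OF tree m] tree_finite[OF tree] by (simp add: sum.If_cases Int_absorb1)
  also have "\<dots> = of_real (f ?m)"
    unfolding of_real_sum[symmetric] sum_increment[OF tree m] ..
  finally show ?thesis .
qed

text \<open>The form is a positive combination of the squares \<open>\<bar>\<Sum>\<^bsub>x \<ge> v\<^esub> c x\<bar>\<^sup>2\<close>; if all of these vanish,
  so does \<open>c\<close>, as one sees at a vertex of maximal depth in its support.\<close>

lemma tree_form_definite:
  assumes pos: "\<And>v. v \<in> pverts T \<Longrightarrow> 0 < increment T r f v"
    and null: "sesq (pverts T) (\<lambda>x y. \<Sum>v\<in>pverts T. tree_feature T r f x v * cnj (tree_feature T r f y v)) c c = 0"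
    and "x \<in> pverts T"
  shows "c x = 0"
proof (rule ccontr)
  assume "c x \<noteq> 0"
  let ?X = "pverts T"
  note fin = tree_finite[OF tree]
  define S where "S = {x \<in> ?X. c x \<noteq> 0}"
  have "finite S" "S \<noteq> {}" using fin \<open>c x \<noteq> 0\<close> \<open>x \<in> ?X\<close> by (auto simp: S_def)
  let ?D = "(\<lambda>y. card (segment T r y)) ` S"
  have "finite ?D" "?D \<noteq> {}" using \<open>finite S\<close> \<open>S \<noteq> {}\<close> by simp_all
  then obtain v where v: "v \<in> S" "card (segment T r v) = Max ?D"
    using Max_in[of ?D] by (metis (no_types, lifting) imageE)
  have max: "card (segment T r y) \<le> card (segment T r v)" if "y \<in> S" for y
    unfolding v(2) using \<open>finite ?D\<close> that by (intro Max_ge) auto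
  have vX: "v \<in> ?X" using v by (simp add: S_def)
  \<comment> \<open>Coordinate v only involves vertices y whose segment contains v. Any such y other
    than v is deeper, so c vanishes there and only the term of v remains.\<close>
  have "c y * tree_feature T r f y v = (if y = v then c v * of_real (sqrt (increment T r f v)) else 0)"
    if y: "y \<in> ?X" for y
  proof (cases "v \<in> segment T r y \<and> y \<noteq> v")
    case True
    then have "segment T r v \<subset> segment T r y"
      using segment_trans[OF tree y] segment_antisym[OF tree y] segment_self[OF tree y] by blast
    then have "card (segment T r v) < card (segment T r y)"
      by (rule psubset_card_mono[OF finite_segment[OF tree]])
    then have "c y = 0" using max y by (force simp: S_def)
    with True show ?thesis by simp
  next
    case False
    then show ?thesis using segment_self[OF tree vX] by (auto simp: tree_feature_def)
  qed
  then have "(\<Sum>y\<in>?X. c y * tree_feature T r f y v) = c v * of_real (sqrt (increment T r f v))"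
    using fin vX by simp
  moreover have "(\<Sum>y\<in>?X. c y * tree_feature T r f y v) = 0"
  proof -
    have "(\<Sum>u\<in>?X. (cmod (\<Sum>y\<in>?X. c y * tree_feature T r f y u))\<^sup>2) = 0"
      using arg_cong[OF null, of Re] unfolding sesq_gram Re_sum Re_mult_cnj_self by simp
    then show ?thesis using fin vX by (simp add: sum_nonneg_eq_0_iff)
  qed
  ultimately show False using v pos[OF vX] by (simp add: S_def)
qed

end

section \<open>Embedding into the ball\<close>

lemma scalar_prod_vec_bij:
  assumes "bij_betw e {0..<n} X"
  shows "vec n (\<lambda>i. f (e i)) \<bullet>c vec n (\<lambda>i. g (e i)) = (\<Sum>v\<in>X. f v * cnj (g v))"
  by (simp add: scalar_prod_def conjugate_complex_def sum.reindex_bij_betw[OF assms, symmetric])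

text \<open>On Y the kernel of every D satisfying \<open>drury_arveson\<close> is
  \<open>DA_kernel\<close>, and a kernel determines the space it spans, so the comparison holds for
  all such D at once.\<close>

lemma is_DA_spanI:
  assumes G: "finite_rkhs G" "pts G = Y" "has_kernel G DA_kernel"
    and ker: "\<And>y. ker G y = restrict0 Y (DA_kernel y)" and Y: "finite Y" "Y \<subseteq> unit_cball n"
  shows "is_DA_span n Y G"
  unfolding is_DA_span_def
proof (intro conjI allI impI G)
  fix D assume D: "drury_arveson n D"
  then have YD: "rkhs D" "Y \<subseteq> pts D" using Y(2) by (auto simp: drury_arveson_def)
  show "same_rkhs_via (\<lambda>y. y) G (rkhs_sub D Y)"
  proof (rule same_rkhs_viaI)
    show "spanned_rkhs G" using G(1) by (rule finite_rkhs_spanned)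
    show "spanned_rkhs (rkhs_sub D Y)" by (rule spanned_rkhs_sub[OF YD(1) Y(1) YD(2)])
    show "bij_betw (\<lambda>y. y) (pts G) (pts (rkhs_sub D Y))" by (simp add: G(2) bij_betw_def)
    show "ker G y = pullback (\<lambda>y. y) (pts G) (ker (rkhs_sub D Y) y)" if "y \<in> pts G" for y
    proof
      fix w
      have "DA_kernel y w = ker D y w" if "w \<in> Y"
        using D Y(2) \<open>y \<in> pts G\<close> that unfolding drury_arveson_def G(2) by (metis subsetD)
      then show "ker G y w = pullback (\<lambda>y. y) (pts G) (ker (rkhs_sub D Y) y) w"
        by (simp add: G(2) ker pullback_def restrict0_def)
    qed
  qed
qed

theorem theorem35:
  fixes T :: "'v pair_pre_digraph" and r :: 'v and \<Omega> :: "'v \<Rightarrow> real"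
  assumes "finite_rooted_tree T r"
    and "\<Omega> r = 1"
    and "\<And>x y. x \<in> pverts T \<Longrightarrow> y \<in> pverts T \<Longrightarrow> tree_less T r y x \<Longrightarrow> \<Omega> y < \<Omega> x"
  shows "\<exists>H :: 'v function_space.
           (finite_rkhs H \<and> pts H = pverts T \<and> has_kernel H (tree_kernel T r \<Omega>)) \<and>
           complete_pick H \<and>
           (\<exists>n>0. \<exists>\<Phi> :: 'v \<Rightarrow> complex vec.
              \<Phi> ` pverts T \<subseteq> unit_cball n \<and> \<Phi> r = 0\<^sub>v n \<and>
              (\<forall>x \<in> pverts T. \<forall>y \<in> pverts T.
                 tree_kernel T r \<Omega> x y = DA_kernel (\<Phi> x) (\<Phi> y) \<and>
                 DA_kernel (\<Phi> x) (\<Phi> y) = complex_of_real (\<Omega> (tree_meet T r x y))) \<and>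
              (\<exists>G. is_DA_span n (\<Phi> ` pverts T) G \<and> same_rkhs_via \<Phi> H G))"
proof -
  note tree = assms(1)
  define X where "X = pverts T"
  define k where "k = tree_kernel T r \<Omega>"
  have X: "finite X" "r \<in> X" using tree_finite[OF tree] tree_root[OF tree] by (simp_all add: X_def)
  have parent: "parent T r v \<in> X" "\<Omega> (parent T r v) < \<Omega> v" if "v \<in> X" "v \<noteq> r" for v
    using segment_parent(1)[OF tree] tree_less_parent[OF tree] assms(3) that by (auto simp: X_def)
  have inc_pos: "0 < increment T r \<Omega> v" if "v \<in> X" for v
    using parent(2)[OF that] assms(2) by (simp add: increment_def[OF tree])
  \<comment> \<open>Positivity, which makes 1 - 1/\<Omega> increasing and less than 1, holds because
    \<Omega> is a sum of positive increments starting from the value 1 at the root.\<close>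
  have \<Omega>_pos: "0 < \<Omega> v" if "v \<in> X" for v
  proof -
    have "\<Omega> v = (\<Sum>u\<in>segment T r v. increment T r \<Omega> u)"
      using sum_increment[OF tree, of v \<Omega>] that by (simp add: X_def)
    also have "\<dots> > 0"
      using that segment_in_verts[OF tree, of v] segment_self[OF tree, of v] finite_segment[OF tree]
      by (intro sum_pos inc_pos) (auto simp: X_def)
    finally show ?thesis .
  qed
  define g where "g = (\<lambda>v. 1 - 1 / \<Omega> v)"
  have inc_g: "0 \<le> increment T r g v" if "v \<in> X" for v
  proof (cases "v = r")
    case False
    have "1 / \<Omega> v \<le> 1 / \<Omega> (parent T r v)"
      using parent[OF that False] \<Omega>_pos by (intro divide_left_mono mult_pos_pos) (auto simp: that)
    with False show ?thesis by (simp add: increment_def[OF tree] g_def)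
  qed (simp add: increment_def[OF tree] g_def assms(2))
  define \<phi> where "\<phi> = tree_feature T r g"
  have meet: "tree_meet T r x y \<in> X" if "x \<in> X" "y \<in> X" for x y
    using tree_meet_in_verts[OF tree] that by (simp add: X_def)
  have \<phi>_gram: "(\<Sum>v\<in>X. \<phi> x v * cnj (\<phi> y v)) = of_real (1 - 1 / \<Omega> (tree_meet T r x y))"
    if "x \<in> X" "y \<in> X" for x y
    using tree_feature_gram[OF tree, of x y g] inc_g that by (simp add: X_def \<phi>_def g_def)
  have k_eq: "k x y = of_real (\<Omega> (tree_meet T r x y))" for x y
    by (simp add: k_def tree_kernel_def)
  have k_inv: "k x y * (1 - (\<Sum>v\<in>X. \<phi> x v * cnj (\<phi> y v))) = 1" if "x \<in> X" "y \<in> X" for x y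
    using \<Omega>_pos[OF meet[OF that]] by (simp add: \<phi>_gram[OF that] k_eq)
  have ball: "(\<Sum>v\<in>X. (cmod (\<phi> x v))\<^sup>2) < 1" if "x \<in> X" for x
  proof -
    have "(\<Sum>v\<in>X. (cmod (\<phi> x v))\<^sup>2) = Re (\<Sum>v\<in>X. \<phi> x v * cnj (\<phi> x v))"
      unfolding Re_sum Re_mult_cnj_self ..
    then show ?thesis using \<Omega>_pos[OF meet[OF that that]] by (simp add: \<phi>_gram[OF that that])
  qed

  define \<psi> where "\<psi> = tree_feature T r \<Omega>"
  have k_gram: "k x y = (\<Sum>v\<in>X. \<psi> x v * cnj (\<psi> y v))" if "x \<in> X" "y \<in> X" for x y
    using tree_feature_gram[OF tree, of x y \<Omega>] inc_pos that
    by (simp add: X_def \<psi>_def k_eq less_imp_le)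
  have k_psd: "psd_on X k"
  proof -
    have "psd_on X k \<longleftrightarrow> psd_on X (\<lambda>x y. \<Sum>v\<in>X. \<psi> x v * cnj (\<psi> y v))"
      by (rule psd_on_cong) (rule k_gram)
    then show ?thesis using psd_on_gram by blast
  qed
  have k_definite: "c x = 0" if "sesq X k c c = 0" "x \<in> X" for c x
  proof -
    have "sesq X (\<lambda>x y. \<Sum>v\<in>X. \<psi> x v * cnj (\<psi> y v)) c c = sesq X k c c"
      by (rule sesq_cong) (auto simp: k_gram)
    with that tree_form_definite[OF tree, of \<Omega> c x] inc_pos show ?thesis
      by (simp add: X_def \<psi>_def)
  qed
  obtain H where H: "finite_rkhs H" "pts H = X" "has_kernel H k"
    and ker_H: "\<And>x. ker H x = restrict0 X (k x)"
    by (rule finite_rkhs_exists[OF X(1) k_psd]) (erule (1) k_definite, blast)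
  have pick: "complete_pick H"
    by (rule complete_pick_of_ball_embedding[OF H(1) X(1), of \<phi>])
      (auto simp: H(2) ball k_inv ker_H restrict0_def)

  \<comment> \<open>One coordinate per vertex. The root coordinate of every image is 0, as 1 -
    1/\<Omega> vanishes there, and counting it keeps n positive for the one-vertex tree.\<close>
  define n where "n = card X"
  have n: "0 < n" using X by (auto simp: n_def card_gt_0_iff)
  obtain e where e: "bij_betw e {0..<n} X"
    using ex_bij_betw_nat_finite[OF X(1)] by (auto simp: n_def)
  define \<Phi> where "\<Phi> = (\<lambda>x. vec n (\<lambda>i. \<phi> x (e i)))"
  have \<Phi>_prod: "\<Phi> x \<bullet>c \<Phi> y = of_real (1 - 1 / \<Omega> (tree_meet T r x y))" if "x \<in> X" "y \<in> X" for x y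
    unfolding \<Phi>_def scalar_prod_vec_bij[OF e] by (rule \<phi>_gram[OF that])
  \<comment> \<open>The kernel takes the product of its arguments in reverse order; symmetry of the
    meet absorbs the swap.\<close>
  have DA: "DA_kernel (\<Phi> x) (\<Phi> y) = k x y" if "x \<in> X" "y \<in> X" for x y
    unfolding DA_kernel_def \<Phi>_prod[OF that(2,1)] tree_meet_commute[OF tree, of y]
    by (simp add: k_eq)
  have \<Phi>_ball: "\<Phi> ` X \<subseteq> unit_cball n"
  proof clarify
    fix x assume x: "x \<in> X"
    have "Re (\<Phi> x \<bullet>c \<Phi> x) < 1"
      using \<Omega>_pos[OF meet[OF x x]] by (simp only: \<Phi>_prod[OF x x] Re_complex_of_real) simp
    then show "\<Phi> x \<in> unit_cball n"
      by (simp add: unit_cball_def cvec_norm_def) (simp add: \<Phi>_def)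
  qed
  have \<Phi>_root: "\<Phi> r = 0\<^sub>v n"
  proof -
    have "\<phi> r v = 0" for v
      by (simp add: \<phi>_def tree_feature_def segment_root_self[OF tree] increment_def[OF tree] g_def assms(2))
    then show ?thesis by (auto simp: \<Phi>_def)
  qed
  have inj: "inj_on \<Phi> X"
  proof (rule inj_onI)
    fix x y assume xy: "x \<in> X" "y \<in> X" "\<Phi> x = \<Phi> y"
    \<comment> \<open>Equal images force \<Omega> to agree at x, y and their meet. As the meet lies
      on both root segments, strict growth of \<Omega> makes it equal to x and to y.\<close>
    have "k x x = k x y" "k y y = k x y" using DA xy by metis+
    then have \<Omega>_eq: "\<Omega> x = \<Omega> (tree_meet T r x y)" "\<Omega> y = \<Omega> (tree_meet T r x y)"
      using xy tree_meet_self[OF tree] by (auto simp: k_eq X_def)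
    let ?m = "tree_meet T r x y"
    have "?m \<in> segment T r x" "?m \<in> segment T r y"
      using segment_meet[OF tree, of x y] segment_self[OF tree, of ?m] meet xy by (auto simp: X_def)
    then have "?m = x" "?m = y"
      using assms(3)[of x ?m] assms(3)[of y ?m] \<Omega>_eq meet xy by (auto simp: X_def tree_less_def)
    then show "x = y" by simp
  qed
  have sesq_\<Phi>: "sesq (\<Phi> ` X) DA_kernel c c = sesq X k (c \<circ> \<Phi>) (c \<circ> \<Phi>)" for c
    unfolding sesq_def by (simp add: sum.reindex[OF inj] DA)
  have DA_psd: "psd_on (\<Phi> ` X) DA_kernel"
    unfolding psd_on_def
  proof (intro conjI ballI allI)
    fix z w assume "z \<in> \<Phi> ` X" "w \<in> \<Phi> ` X"
    then show "DA_kernel w z = cnj (DA_kernel z w)"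
      by (auto simp: DA k_eq intro: arg_cong[OF tree_meet_commute[OF tree]])
  next
    show "0 \<le> Re (sesq (\<Phi> ` X) DA_kernel c c)" for c
      unfolding sesq_\<Phi> by (rule sesq_self(2)[OF k_psd])
  qed
  have DA_definite: "c z = 0" if "sesq (\<Phi> ` X) DA_kernel c c = 0" "z \<in> \<Phi> ` X" for c z
    using that k_definite[of "c \<circ> \<Phi>"] by (auto simp: sesq_\<Phi>)
  obtain G where G: "finite_rkhs G" "pts G = \<Phi> ` X" "has_kernel G DA_kernel"
    and ker_G: "\<And>z. ker G z = restrict0 (\<Phi> ` X) (DA_kernel z)"
    by (rule finite_rkhs_exists[OF finite_imageI[OF X(1)] DA_psd]) (erule (1) DA_definite, blast)
  have "is_DA_span n (\<Phi> ` X) G"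
    using X(1) \<Phi>_ball by (intro is_DA_spanI G ker_G) simp_all
  moreover have "same_rkhs_via \<Phi> H G"
  proof (rule same_rkhs_viaI)
    show "spanned_rkhs H" "spanned_rkhs G" using H(1) G(1) by (auto intro: finite_rkhs_spanned)
    show "bij_betw \<Phi> (pts H) (pts G)" using inj by (simp add: H(2) G(2) bij_betw_def)
    show "ker H x = pullback \<Phi> (pts H) (ker G (\<Phi> x))" if "x \<in> pts H" for x
      using that by (auto simp: H(2) ker_H ker_G pullback_def restrict0_def DA)
  qed
  moreover have "\<forall>x\<in>X. \<forall>y\<in>X. tree_kernel T r \<Omega> x y = DA_kernel (\<Phi> x) (\<Phi> y) \<and>
      DA_kernel (\<Phi> x) (\<Phi> y) = complex_of_real (\<Omega> (tree_meet T r x y))"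
    using DA by (simp add: k_eq flip: k_def)
  ultimately show ?thesis
    unfolding X_def[symmetric] k_def[symmetric]
    using H pick n \<Phi>_ball \<Phi>_root by blast
qed

end
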